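(* Let $P\subset\mathbb{R}^d$ be a finite set of doubling dimension $\mathrm{ddim}(P)$, let $k\le|P|$ and $0<\epsilon<1/2$, and let $G\in\mathbb{R}^{t\times d}$ be a matrix of i.i.d. Gaussians $N(0,\tfrac1t)$ for a suitable $t=O(\tfrac{\log k}{\epsilon^2}+\tfrac{\log(1/\epsilon)}{\epsilon^2}\mathrm{ddim}(P))$. Then with probability at least $2/3$: (1) the vanilla $k$-center value of $G(P)$ is a $(1+\epsilon)$-approximation of the vanilla $k$-center value of $P$; and (2) for every $\alpha\ge1$, every $C\subset P$ with $|C|=k$ is an $\alpha(1+\epsilon)$-approximate vanilla $k$-center solution of $P$ whenever $G(C)$ is an $\alpha$-approximate vanilla $k$-center solution of $G(P)$.
   Context: Euclidean norms; $B(x,r)$ is the closed ball. The doubling dimension $\mathrm{ddim}(P)$ of $P\subset\mathbb{R}^d$ is the smallest number such that every ball in $P$ (i.e., $P\cap B(x,r)$ with $x\in P$) can be covered by $2^{\mathrm{ddim}(P)}$ balls in $P$ of half the radius. For a finite $X\subset\mathbb{R}^m$, $\mathrm{OPT}_{vanilla}(X)=\min_{C\subset\mathbb{R}^m,|C|=k}\max_{x\in X}\min_{c\in C}\|x-c\|$. "$(1+\epsilon)$-approximation of the value" means the two values agree up to a factor $1+\epsilon$. A set $C\subset X$ of size $k$ is a $\gamma$-approximate solution of $X$ if $\max_{x\in X}\min_{c\in C}\|x-c\|\le\gamma\,\mathrm{OPT}_{vanilla}(X)$. $G(X)=\{Gx:x\in X\}$. *)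

theory Defs
  imports "HOL-Probability.Probability"
begin

text \<open>Points of R^m are represented as functions nat => real vanishing outside {0..<m}.\<close>

definition vecs :: "nat \<Rightarrow> (nat \<Rightarrow> real) set" where
  "vecs m = {x. \<forall>i\<ge>m. x i = 0}"

definition edist :: "nat \<Rightarrow> (nat \<Rightarrow> real) \<Rightarrow> (nat \<Rightarrow> real) \<Rightarrow> real" where
  "edist m x y = sqrt (\<Sum>i<m. (x i - y i)^2)"

definition cballP :: "nat \<Rightarrow> (nat \<Rightarrow> real) set \<Rightarrow> (nat \<Rightarrow> real) \<Rightarrow> real \<Rightarrow> (nat \<Rightarrow> real) set" where
  "cballP m P x r = {y \<in> P. edist m x y \<le> r}"

definition ddim :: "nat \<Rightarrow> (nat \<Rightarrow> real) set \<Rightarrow> real" where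
  "ddim m P = Inf {D::real. 0 \<le> D \<and> (\<forall>x\<in>P. \<forall>r>0. \<exists>S. S \<subseteq> P \<and> finite S \<and>
       real (card S) \<le> 2 powr D \<and> cballP m P x r \<subseteq> (\<Union>s\<in>S. cballP m P s (r/2)))}"

definition kcost :: "nat \<Rightarrow> (nat \<Rightarrow> real) set \<Rightarrow> (nat \<Rightarrow> real) set \<Rightarrow> real" where
  "kcost m X C = Max ((\<lambda>x. Min ((\<lambda>c. edist m x c) ` C)) ` X)"

definition opt_vanilla :: "nat \<Rightarrow> nat \<Rightarrow> (nat \<Rightarrow> real) set \<Rightarrow> real" where
  "opt_vanilla m k X = (INF C\<in>{C. C \<subseteq> vecs m \<and> finite C \<and> card C = k}. kcost m X C)"

definition approx_sol :: "nat \<Rightarrow> nat \<Rightarrow> real \<Rightarrow> (nat \<Rightarrow> real) set \<Rightarrow> (nat \<Rightarrow> real) set \<Rightarrow> bool" where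
  "approx_sol m k \<gamma> X C \<longleftrightarrow> C \<subseteq> X \<and> card C = k \<and> kcost m X C \<le> \<gamma> * opt_vanilla m k X"

definition mat_app :: "nat \<Rightarrow> nat \<Rightarrow> (nat \<times> nat \<Rightarrow> real) \<Rightarrow> (nat \<Rightarrow> real) \<Rightarrow> (nat \<Rightarrow> real)" where
  "mat_app t d G x = (\<lambda>i. if i < t then (\<Sum>j<d. G (i, j) * x j) else 0)"

definition gauss_mat :: "nat \<Rightarrow> nat \<Rightarrow> (nat \<times> nat \<Rightarrow> real) measure" where
  "gauss_mat t d = PiM ({0..<t} \<times> {0..<d}) (\<lambda>_. density lborel (normal_density 0 (1 / sqrt (real t))))"

end

theory Submission
  imports Defs
begin

text \<open>Let \<open>R\<close> be (nearly) the optimal value of \<open>P\<close>, attained by centres \<open>C0\<close>, and let \<open>\<delta>\<close> be a small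
  multiple of \<open>\<epsilon>\<close>. Halving the \<open>k\<close> clusters about \<open>log (1/\<delta>)\<close> times gives a \<open>\<delta> R\<close>-net \<open>N\<close> of \<open>P\<close>
  with \<open>k (1/\<delta>)^O(ddim P)\<close> points. A union bound over the pairs in \<open>N \<union> C0\<close> shows that \<open>G\<close> distorts
  all their distances by at most \<open>1 \<plusminus> \<delta>\<close>, and a chaining argument shows that the image of every net
  ball of radius \<open>\<delta> R\<close> still has radius \<open>O(\<delta> R)\<close>. Hence distances in \<open>P\<close> change by a factor
  \<open>1 + O(\<delta>)\<close> and an additive \<open>O(\<delta> R)\<close> only. This yields the upper bound in (1), by mapping \<open>C0\<close>
  with \<open>G\<close>, and it yields (2). For the lower bound in (1), a centre in the target space need not be
  the image of a point. However, the radius of the minimum enclosing ball of a finite set is monotone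
  in the pairwise distances (Kirszbraun's theorem for one additional point), so that each cluster of
  net points can be enclosed in the source space.\<close>

subsection \<open>Gaussian matrices\<close>

text \<open>Independence means that the joint law is the product of the marginals, and the joint law
  of all coordinates is the product measure itself.\<close>

lemma indep_vars_PiM_coordinates:
  assumes "\<And>i. i \<in> I \<Longrightarrow> prob_space (N i)" "I \<noteq> {}"
  shows "prob_space.indep_vars (PiM I N) N (\<lambda>i \<omega>. \<omega> i) I"
proof -
  interpret prob_space "PiM I N" by (intro prob_space_PiM assms)
  have "distr (PiM I N) (PiM I N) (\<lambda>x. \<lambda>i\<in>I. x i) = distr (PiM I N) (PiM I N) (\<lambda>x. x)"
    by (intro distr_cong) (auto simp: space_PiM)
  also have "\<dots> = PiM I N" by simp
  also have "\<dots> = PiM I (\<lambda>i. distr (PiM I N) (N i) (\<lambda>\<omega>. \<omega> i))"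
    by (intro PiM_cong refl distr_PiM_component[symmetric] assms)
  finally show ?thesis
    using assms(2) by (subst indep_vars_iff_distr_eq_PiM') auto
qed

lemma prob_space_gauss_mat: "prob_space (gauss_mat t d)"
  unfolding gauss_mat_def by (intro prob_space_PiM prob_space_normal_density) auto

definition sqn :: "nat \<Rightarrow> (nat \<Rightarrow> real) \<Rightarrow> real" where
  "sqn m v = (\<Sum>i<m. (v i)\<^sup>2)"

text \<open>A coordinate of \<open>G v\<close> is a sum of independent centred Gaussians of
  variances \<open>(v j)^2 / t\<close>, and variances add.\<close>

lemma distributed_mat_app_row:
  assumes "t \<ge> 1" "sqn d v > 0" "i < t"
  shows "distributed (gauss_mat t d) lborel (\<lambda>G. \<Sum>j<d. G (i,j) * v j)
           (normal_density 0 (sqrt (sqn d v / real t)))"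
proof -
  interpret prob_space "gauss_mat t d" by (rule prob_space_gauss_mat)
  \<comment> \<open>A summand with \<open>v j = 0\<close> is a point mass and has no density, so
    only the nonzero coordinates are summed.\<close>
  define J where "J = {j\<in>{..<d}. v j \<noteq> 0}"
  have sumJ: "(\<Sum>j<d. f j) = sum f J" if "\<And>j. v j = 0 \<Longrightarrow> f j = 0" for f :: "nat \<Rightarrow> real"
    unfolding J_def by (intro sum.mono_neutral_right) (auto simp: that)
  have "J \<noteq> {}"
    using assms(2) sumJ[of "\<lambda>j. (v j)\<^sup>2"] by (auto simp: sqn_def)
  let ?N = "density lborel (normal_density 0 (1 / sqrt (real t)))"
  have prN: "prob_space ?N"
    using \<open>t \<ge> 1\<close> by (intro prob_space_normal_density) simp
  have dist1: "distributed (gauss_mat t d) lborel (\<lambda>G. G (i,j)) (normal_density 0 (1 / sqrt (real t)))"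
    if "j \<in> J" for j
  proof -
    have "distr (gauss_mat t d) ?N (\<lambda>G. G (i,j)) = ?N"
      unfolding gauss_mat_def using that assms prN
      by (intro distr_PiM_component) (auto simp: J_def)
    moreover have "distr (gauss_mat t d) lborel (\<lambda>G. G (i,j)) = distr (gauss_mat t d) ?N (\<lambda>G. G (i,j))"
      by (intro distr_cong) auto
    moreover have "(\<lambda>G. G (i,j)) \<in> gauss_mat t d \<rightarrow>\<^sub>M ?N"
      unfolding gauss_mat_def using that assms
      by (intro measurable_component_singleton) (auto simp: J_def)
    ultimately show ?thesis
      by (simp add: distributed_def)
  qed
  have ind0: "indep_vars (\<lambda>_. ?N) (\<lambda>p G. G p) ({0..<t} \<times> {0..<d})"
    unfolding gauss_mat_def using \<open>J \<noteq> {}\<close> assms prN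
    by (intro indep_vars_PiM_coordinates) (auto simp: J_def)
  have "indep_vars (\<lambda>_. ?N) (\<lambda>p G. G p) (Pair i ` J)"
    by (rule indep_vars_subset[OF ind0]) (use assms in \<open>auto simp: J_def\<close>)
  then have ind: "indep_vars (\<lambda>_. borel) (\<lambda>p G. 0 + v (snd p) * G p) (Pair i ` J)"
    by (rule indep_vars_compose2) simp
  have "distributed (gauss_mat t d) lborel (\<lambda>G. \<Sum>p\<in>Pair i ` J. 0 + v (snd p) * G p)
     (normal_density (\<Sum>p\<in>Pair i ` J. 0 + v (snd p) * 0)
       (sqrt (\<Sum>p\<in>Pair i ` J. (\<bar>v (snd p)\<bar> * (1 / sqrt (real t)))\<^sup>2)))"
  proof (rule sum_indep_normal[OF _ _ ind])
    fix p assume "p \<in> Pair i ` J"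
    then obtain j where p: "p = (i,j)" and j: "j \<in> J" by auto
    show "0 < \<bar>v (snd p)\<bar> * (1 / sqrt (real t))" using j \<open>t \<ge> 1\<close> by (simp add: J_def p)
    show "distributed (gauss_mat t d) lborel (\<lambda>G. 0 + v (snd p) * G p)
            (normal_density (0 + v (snd p) * 0) (\<bar>v (snd p)\<bar> * (1 / sqrt (real t))))"
      unfolding p snd_conv
      by (rule normal_density_affine[OF dist1[OF j]]) (use j \<open>t \<ge> 1\<close> in \<open>auto simp: J_def\<close>)
  qed (use \<open>J \<noteq> {}\<close> in \<open>auto simp: J_def\<close>)
  then have "distributed (gauss_mat t d) lborel (\<lambda>G. \<Sum>j\<in>J. 0 + v j * G (i,j))
     (normal_density (\<Sum>j\<in>J. 0 + v j * 0) (sqrt (\<Sum>j\<in>J. (\<bar>v j\<bar> * (1 / sqrt (real t)))\<^sup>2)))"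
    by (simp add: sum.reindex inj_on_def)
  moreover have "(\<Sum>j\<in>J. (\<bar>v j\<bar> * (1 / sqrt (real t)))\<^sup>2) = sqn d v / real t"
    by (simp add: sqn_def sumJ power_divide sum_divide_distrib)
  moreover have "(\<lambda>G. \<Sum>j\<in>J. 0 + v j * G (i,j)) = (\<lambda>G. \<Sum>j<d. G (i,j) * v j)"
    by (simp add: sumJ mult.commute)
  ultimately show ?thesis by simp
qed

text \<open>The moment generating function of a chi-square variable: the exponential factor turns
  the density into a multiple of the normal density of variance
  \<open>\<sigma>^2 / (1 - x)\<close>.\<close>

lemma nn_integral_exp_square_normal:
  assumes "distributed M lborel X (normal_density 0 \<sigma>)" "\<sigma> > 0" "x < 1"
  shows "(\<integral>\<^sup>+\<omega>. ennreal (exp (x * (X \<omega>)\<^sup>2 / (2 * \<sigma>\<^sup>2))) \<partial>M) = ennreal (1 / sqrt (1 - x))"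
proof -
  define \<tau> where "\<tau> = \<sigma> / sqrt (1 - x)"
  have \<tau>: "\<tau> > 0" "\<tau>\<^sup>2 = \<sigma>\<^sup>2 / (1 - x)" using assms by (auto simp: \<tau>_def power_divide)
  have eq: "normal_density 0 \<sigma> y * exp (x * y\<^sup>2 / (2 * \<sigma>\<^sup>2)) = 1 / sqrt (1 - x) * normal_density 0 \<tau> y" for y
  proof -
    have "exp (- y\<^sup>2 / (2 * \<sigma>\<^sup>2)) * exp (x * y\<^sup>2 / (2 * \<sigma>\<^sup>2)) = exp (- y\<^sup>2 / (2 * \<tau>\<^sup>2))"
      unfolding exp_add[symmetric] \<tau>(2) using assms by (simp add: divide_simps) (simp add: algebra_simps)
    moreover have "1 / sqrt (2 * pi * \<sigma>\<^sup>2) = 1 / sqrt (1 - x) * (1 / sqrt (2 * pi * \<tau>\<^sup>2))"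
      unfolding \<tau>(2) using assms by (simp add: real_sqrt_mult real_sqrt_divide)
    ultimately show ?thesis
      by (simp add: normal_density_def mult.assoc)
  qed
  have "(\<integral>\<^sup>+\<omega>. ennreal (exp (x * (X \<omega>)\<^sup>2 / (2 * \<sigma>\<^sup>2))) \<partial>M)
      = (\<integral>\<^sup>+y. ennreal (normal_density 0 \<sigma> y) * ennreal (exp (x * y\<^sup>2 / (2 * \<sigma>\<^sup>2))) \<partial>lborel)"
    by (rule distributed_nn_integral[OF assms(1), symmetric]) measurable
  also have "\<dots> = (\<integral>\<^sup>+y. ennreal (1 / sqrt (1 - x)) * ennreal (normal_density 0 \<tau> y) \<partial>lborel)"
    using assms by (intro nn_integral_cong) (simp add: eq flip: ennreal_mult)
  also have "\<dots> = ennreal (1 / sqrt (1 - x)) * (\<integral>\<^sup>+y. ennreal (normal_density 0 \<tau> y) \<partial>lborel)"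
    by (rule nn_integral_cmult) measurable
  also have "(\<integral>\<^sup>+y. ennreal (normal_density 0 \<tau> y) \<partial>lborel) = 1"
    using prob_space.emeasure_space_1[OF prob_space_normal_density[OF \<tau>(1), of 0]] by (simp add: emeasure_density)
  finally show ?thesis by simp
qed

text \<open>Distinct rows read disjoint blocks of independent entries.\<close>

lemma indep_vars_gauss_rows:
  assumes "t \<ge> 1" "d \<ge> 1"
  shows "prob_space.indep_vars (gauss_mat t d) (\<lambda>_. borel) (\<lambda>i G. \<Sum>j<d. G (i,j) * v j) {..<t}"
proof -
  interpret prob_space "gauss_mat t d" by (rule prob_space_gauss_mat)
  let ?N = "density lborel (normal_density 0 (1 / sqrt (real t)))"
  have "indep_vars (\<lambda>_. ?N) (\<lambda>p G. G p) ({0..<t} \<times> {0..<d})"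
    unfolding gauss_mat_def using assms
    by (intro indep_vars_PiM_coordinates prob_space_normal_density) auto
  then have "indep_vars (\<lambda>i. PiM ({i} \<times> {0..<d}) (\<lambda>_. ?N))
      (\<lambda>i G. restrict (\<lambda>p. G p) ({i} \<times> {0..<d})) {..<t}"
    by (rule indep_vars_restrict) (auto simp: disjoint_family_on_def)
  then have "indep_vars (\<lambda>_. borel)
      (\<lambda>i G. (\<lambda>H. \<Sum>j<d. H (i,j) * v j) (restrict (\<lambda>p. G p) ({i} \<times> {0..<d}))) {..<t}"
  proof (rule indep_vars_compose2)
    fix i
    have "(\<lambda>H. H (i,j)) \<in> borel_measurable (PiM ({i} \<times> {0..<d}) (\<lambda>_. ?N))" if "j < d" for j
    proof -
      have "(\<lambda>H. H (i,j)) \<in> PiM ({i} \<times> {0..<d}) (\<lambda>_. ?N) \<rightarrow>\<^sub>M ?N"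
        using that by (intro measurable_component_singleton) auto
      then show ?thesis by simp
    qed
    then show "(\<lambda>H. \<Sum>j<d. H (i,j) * v j) \<in> borel_measurable (PiM ({i} \<times> {0..<d}) (\<lambda>_. ?N))"
      by (intro borel_measurable_sum borel_measurable_times) auto
  qed
  then show ?thesis by simp
qed

text \<open>Chernoff bound: Markov's inequality for the exponential of a multiple of
  \<open>|G v|^2\<close>, whose mean is a product over the rows. The sign of \<open>x\<close> is
  left open: a positive \<open>x\<close> bounds the upper tail, a negative one the lower
  tail.\<close>

lemma gauss_mat_tail:
  assumes "t \<ge> 1" "sqn d v > 0" "x < 1"
  shows "{G \<in> space (gauss_mat t d). x * (B * sqn d v) \<le> x * sqn t (mat_app t d G v)} \<in> sets (gauss_mat t d)" (is ?meas)
    and "measure (gauss_mat t d) {G \<in> space (gauss_mat t d). x * (B * sqn d v) \<le> x * sqn t (mat_app t d G v)}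
          \<le> exp (- (real t / 2) * (ln (1 - x) + x * B))" (is ?tail)
proof -
  let ?M = "gauss_mat t d"
  interpret prob_space ?M by (rule prob_space_gauss_mat)
  define Y where "Y i G = (\<Sum>j<d. G (i,j) * v j)" for i :: nat and G :: "nat \<times> nat \<Rightarrow> real"
  define \<sigma> where "\<sigma> = sqrt (sqn d v / real t)"
  have \<sigma>: "\<sigma> > 0" "\<sigma>\<^sup>2 = sqn d v / real t" using assms by (auto simp: \<sigma>_def)
  have "d \<ge> 1" using assms(2) by (cases d) (auto simp: sqn_def)
  then have indY: "indep_vars (\<lambda>_. borel) Y {..<t}"
    unfolding Y_def using indep_vars_gauss_rows[OF \<open>t \<ge> 1\<close>] by simp
  have Ym[measurable]: "Y i \<in> borel_measurable ?M" if "i < t" for i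
    using indY that by (auto simp: indep_vars_def)
  have app: "sqn t (mat_app t d G v) = (\<Sum>i<t. (Y i G)\<^sup>2)" for G
    by (simp add: sqn_def mat_app_def Y_def)
  have sqm[measurable]: "(\<lambda>G. sqn t (mat_app t d G v)) \<in> borel_measurable ?M"
    unfolding app by (intro borel_measurable_sum borel_measurable_power Ym) simp
  show ?meas by measurable
  define u where "u G = ennreal (exp (x * sqn t (mat_app t d G v) / (2 * \<sigma>\<^sup>2)))" for G
  define c where "c = ennreal (exp (- (x * (B * sqn d v) / (2 * \<sigma>\<^sup>2))))"
  have u_eq: "(\<Prod>i<t. ennreal (exp (x * (Y i G)\<^sup>2 / (2 * \<sigma>\<^sup>2)))) = u G" for G
    unfolding u_def app by (simp add: prod_ennreal exp_sum[symmetric] sum_distrib_left sum_divide_distrib)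
  have "indep_vars (\<lambda>_. borel) (\<lambda>i G. ennreal (exp (x * (Y i G)\<^sup>2 / (2 * \<sigma>\<^sup>2)))) {..<t}"
    by (rule indep_vars_compose2[OF indY]) measurable
  then have "(\<integral>\<^sup>+G. (\<Prod>i<t. ennreal (exp (x * (Y i G)\<^sup>2 / (2 * \<sigma>\<^sup>2)))) \<partial>?M)
      = (\<Prod>i<t. \<integral>\<^sup>+G. ennreal (exp (x * (Y i G)\<^sup>2 / (2 * \<sigma>\<^sup>2))) \<partial>?M)"
    by (intro indep_vars_nn_integral) auto
  also have "\<dots> = (\<Prod>i<t. ennreal (1 / sqrt (1 - x)))"
  proof (intro prod.cong refl)
    fix i assume "i \<in> {..<t}"
    then show "(\<integral>\<^sup>+G. ennreal (exp (x * (Y i G)\<^sup>2 / (2 * \<sigma>\<^sup>2))) \<partial>?M) = ennreal (1 / sqrt (1 - x))"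
      using distributed_mat_app_row[OF assms(1,2), of i] \<sigma>(1) assms(3)
      by (intro nn_integral_exp_square_normal) (auto simp: Y_def[abs_def] \<sigma>_def)
  qed
  also have "\<dots> = ennreal ((1 / sqrt (1 - x)) ^ t)"
    using assms by (simp add: ennreal_power del: power_one_over)
  also have "(1 / sqrt (1 - x)) ^ t = exp (- (real t / 2) * ln (1 - x))"
  proof -
    have "1 / sqrt (1 - x) = exp (- (ln (1 - x) / 2))"
      using assms by (simp add: exp_minus ln_sqrt[symmetric] inverse_eq_divide)
    then have "(1 / sqrt (1 - x)) ^ t = exp (real t * (- (ln (1 - x) / 2)))"
      by (simp only: exp_of_nat_mult)
    then show ?thesis by simp
  qed
  finally have int: "(\<integral>\<^sup>+G. u G \<partial>?M) = ennreal (exp (- (real t / 2) * ln (1 - x)))"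
    by (simp only: u_eq)
  have um: "u \<in> borel_measurable ?M" unfolding u_def[abs_def] by measurable
  have "{G \<in> space ?M. x * (B * sqn d v) \<le> x * sqn t (mat_app t d G v)} = {G \<in> space ?M. 1 \<le> c * u G}"
  proof (intro Collect_cong conj_cong refl)
    fix G
    have "c * u G = ennreal (exp ((x * sqn t (mat_app t d G v) - x * (B * sqn d v)) / (2 * \<sigma>\<^sup>2)))"
      unfolding c_def u_def by (simp add: ennreal_mult[symmetric] exp_add[symmetric] diff_divide_distrib)
    then show "(x * (B * sqn d v) \<le> x * sqn t (mat_app t d G v)) = (1 \<le> c * u G)"
      using \<sigma>(1) by (simp add: zero_le_divide_iff)
  qed
  also have "emeasure ?M \<dots> \<le> c * (\<integral>\<^sup>+G. u G * indicator (space ?M) G \<partial>?M)"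
    by (rule nn_integral_Markov_inequality) (use um in \<open>auto\<close>)
  also have "(\<integral>\<^sup>+G. u G * indicator (space ?M) G \<partial>?M) = (\<integral>\<^sup>+G. u G \<partial>?M)"
    by (intro nn_integral_cong) simp
  also have "c * \<dots> = ennreal (exp (- (real t / 2) * (ln (1 - x) + x * B)))"
    unfolding int c_def \<sigma>(2) using assms
    by (simp add: ennreal_mult[symmetric] exp_add[symmetric] field_simps)
  finally show ?tail
    by (simp add: emeasure_eq_measure)
qed

section \<open>Properties that hold outside a small exceptional set\<close>

text \<open>Failures are enclosed in a measurable set, so that union bounds apply to properties
  whose measurability is never established, such as those about optimal values.\<close>

definition except_prob :: "'a measure \<Rightarrow> real \<Rightarrow> ('a \<Rightarrow> bool) \<Rightarrow> bool" where
  "except_prob M p Q \<longleftrightarrow> (\<exists>B\<in>sets M. measure M B \<le> p \<and> (\<forall>G\<in>space M - B. Q G))"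

lemma except_prob_mono:
  "except_prob M p Q \<Longrightarrow> p \<le> q \<Longrightarrow> (\<And>G. Q G \<Longrightarrow> Q' G) \<Longrightarrow> except_prob M q Q'"
  unfolding except_prob_def by (metis order_trans)

lemma except_prob_always: "(\<And>G. Q G) \<Longrightarrow> 0 \<le> p \<Longrightarrow> except_prob M p Q"
  unfolding except_prob_def by (intro bexI[of _ "{}"]) auto

lemma (in finite_measure) except_prob_ball:
  assumes "finite I" "\<And>i. i \<in> I \<Longrightarrow> except_prob M p (Q i)"
  shows "except_prob M (real (card I) * p) (\<lambda>G. \<forall>i\<in>I. Q i G)"
proof -
  from assms(2) obtain B where B: "\<And>i. i \<in> I \<Longrightarrow> B i \<in> sets M \<and> measure M (B i) \<le> p \<and> (\<forall>G\<in>space M - B i. Q i G)"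
    unfolding except_prob_def by metis
  have "measure M (\<Union>i\<in>I. B i) \<le> (\<Sum>i\<in>I. measure M (B i))"
    using B by (intro finite_measure_subadditive_finite assms) auto
  also have "\<dots> \<le> real (card I) * p"
    using B by (intro sum_bounded_above) auto
  finally show ?thesis
    unfolding except_prob_def using B assms(1) by (intro bexI[of _ "\<Union>i\<in>I. B i"]) auto
qed

lemma (in finite_measure) except_prob_conj:
  assumes "except_prob M p Q" "except_prob M q R"
  shows "except_prob M (p + q) (\<lambda>G. Q G \<and> R G)"
proof -
  from assms obtain A B where AB: "A \<in> sets M" "measure M A \<le> p" "\<forall>G\<in>space M - A. Q G"
      "B \<in> sets M" "measure M B \<le> q" "\<forall>G\<in>space M - B. R G"
    unfolding except_prob_def by blast
  have "measure M (A \<union> B) \<le> p + q"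
    using measure_Un_le[of A M B] AB by linarith
  then show ?thesis
    unfolding except_prob_def using AB by (intro bexI[of _ "A \<union> B"]) auto
qed

section \<open>Distortion of a single distance\<close>

lemma edist_eq_sqn: "edist m x y = sqrt (sqn m (\<lambda>i. x i - y i))"
  by (simp add: edist_def sqn_def)

lemma edist_mat_app:
  "edist t (mat_app t d G u) (mat_app t d G w) = sqrt (sqn t (mat_app t d G (\<lambda>i. u i - w i)))"
  by (simp add: edist_def sqn_def mat_app_def right_diff_distrib sum_subtractf)

lemma sqn_nonneg: "0 \<le> sqn m v"
  by (simp add: sqn_def sum_nonneg)

lemma edist_nonneg: "0 \<le> edist m x y"
  by (simp add: edist_eq_sqn sqn_nonneg)

lemma sqn_mat_app_0: "sqn d v = 0 \<Longrightarrow> sqn t (mat_app t d G v) = 0"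
  by (simp add: sqn_def sum_nonneg_eq_0_iff mat_app_def)

text \<open>A crude bound for large \<open>b\<close>, as the chaining needs it: the Chernoff
  parameter 1/2 gives the exponent \<open>t * (b^2 / 4 - ln 2 / 2)\<close>, and
  \<open>ln 2 / 2 <= 7/20\<close>.\<close>

lemma except_prob_expansion:
  assumes "t \<ge> 1" "b \<ge> 0"
  shows "except_prob (gauss_mat t d) (exp (- real t * (b\<^sup>2 / 4 - 7/20)))
    (\<lambda>G. edist t (mat_app t d G u) (mat_app t d G w) \<le> b * edist d u w)"
proof (cases "sqn d (\<lambda>i. u i - w i) = 0")
  \<comment> \<open>At distance zero, where the tail bound does not apply, the image distance is
    zero as well.\<close>
  case True
  then show ?thesis
    by (intro except_prob_always) (auto simp: edist_mat_app sqn_mat_app_0 edist_eq_sqn[of d])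
next
  case False
  define v where "v = (\<lambda>i. u i - w i)"
  have v: "sqn d v > 0" using False sqn_nonneg[of d v] by (simp add: v_def)
  note T = gauss_mat_tail[OF assms(1) v, of "1/2" "b\<^sup>2"]
  have "ln (1 - 1/2 :: real) \<ge> - (7/10)"
    using ln2_le_25_over_36 by (simp add: ln_div)
  then have "real t * (b\<^sup>2 / 4 - 7/20) \<le> real t * ((ln (1 - 1/2) + 1/2 * b\<^sup>2) / 2)"
    by (intro mult_left_mono) auto
  then have p: "exp (- (real t / 2) * (ln (1 - 1/2) + 1/2 * b\<^sup>2)) \<le> exp (- real t * (b\<^sup>2 / 4 - 7/20))"
    by simp
  show ?thesis
    unfolding except_prob_def
  proof (intro bexI conjI ballI)
    fix G assume "G \<in> space (gauss_mat t d)
      - {G \<in> space (gauss_mat t d). 1/2 * (b\<^sup>2 * sqn d v) \<le> 1/2 * sqn t (mat_app t d G v)}"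
    then have "sqn t (mat_app t d G v) \<le> b\<^sup>2 * sqn d v" by auto
    then have "sqrt (sqn t (mat_app t d G v)) \<le> sqrt (b\<^sup>2 * sqn d v)"
      by (rule real_sqrt_le_mono)
    then show "edist t (mat_app t d G u) (mat_app t d G w) \<le> b * edist d u w"
      using assms(2) by (simp add: edist_mat_app edist_eq_sqn[of d] v_def real_sqrt_mult)
  next
    show "measure (gauss_mat t d) {G \<in> space (gauss_mat t d). 1/2 * (b\<^sup>2 * sqn d v) \<le> 1/2 * sqn t (mat_app t d G v)}
       \<le> exp (- real t * (b\<^sup>2 / 4 - 7/20))"
      by (rule order_trans[OF T(2) p]) simp
  qed (rule T(1), simp)
qed

text \<open>It suffices that the squared length changes by a factor between
  \<open>1 - \<delta>\<close> and \<open>1 + \<delta>\<close>, because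
  \<open>(1 - \<delta>)^2 <= 1 - \<delta>\<close> and
  \<open>1 + \<delta> <= (1 + \<delta>)^2\<close>.\<close>

lemma except_prob_distortion:
  assumes "t \<ge> 1" "0 < \<delta>" "\<delta> < 1"
  shows "except_prob (gauss_mat t d) (2 * exp (- real t * \<delta>\<^sup>2 / 16))
    (\<lambda>G. (1 - \<delta>) * edist d u w \<le> edist t (mat_app t d G u) (mat_app t d G w) \<and>
         edist t (mat_app t d G u) (mat_app t d G w) \<le> (1 + \<delta>) * edist d u w)"
proof (cases "sqn d (\<lambda>i. u i - w i) = 0")
  case True
  then show ?thesis
    by (intro except_prob_always) (auto simp: edist_mat_app sqn_mat_app_0 edist_eq_sqn[of d])
next
  case False
  define v where "v = (\<lambda>i. u i - w i)"
  have v: "sqn d v > 0" using False sqn_nonneg[of d v] by (simp add: v_def)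
  interpret prob_space "gauss_mat t d" by (rule prob_space_gauss_mat)
  have upper: "except_prob (gauss_mat t d) (exp (- real t * \<delta>\<^sup>2 / 16))
    (\<lambda>G. edist t (mat_app t d G u) (mat_app t d G w) \<le> (1 + \<delta>) * edist d u w)"
    unfolding except_prob_def
  proof (intro bexI conjI ballI)
    \<comment> \<open>For \<open>x = \<delta>/4\<close> the estimate
      \<open>ln (1 - x) >= - x - 2 * x^2\<close> makes
      \<open>ln (1 - x) + x * (1 + \<delta>)\<close> at least \<open>\<delta>^2 / 8\<close>.\<close>
    note T = gauss_mat_tail[OF assms(1) v, of "\<delta>/4" "1 + \<delta>"]
    let ?A = "{G \<in> space (gauss_mat t d). \<delta>/4 * ((1 + \<delta>) * sqn d v) \<le> \<delta>/4 * sqn t (mat_app t d G v)}"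
    show "?A \<in> events" by (rule T(1)) (use assms in simp)
    have "- (\<delta>/4) - 2 * (\<delta>/4)\<^sup>2 \<le> ln (1 - \<delta>/4)"
      by (rule ln_one_minus_pos_lower_bound) (use assms in auto)
    then have "\<delta>\<^sup>2 / 8 \<le> ln (1 - \<delta>/4) + \<delta>/4 * (1 + \<delta>)"
      by (simp add: field_simps power2_eq_square)
    then have "(real t / 2) * (\<delta>\<^sup>2 / 8) \<le> (real t / 2) * (ln (1 - \<delta>/4) + \<delta>/4 * (1 + \<delta>))"
      by (intro mult_left_mono) auto
    then have "exp (- (real t / 2) * (ln (1 - \<delta>/4) + \<delta>/4 * (1 + \<delta>))) \<le> exp (- real t * \<delta>\<^sup>2 / 16)"
      by simp
    then show "prob ?A \<le> exp (- real t * \<delta>\<^sup>2 / 16)"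
      by (rule order_trans[rotated]) (rule T(2), use assms in simp)
    fix G assume "G \<in> space (gauss_mat t d) - ?A"
    then have "sqn t (mat_app t d G v) \<le> (1 + \<delta>) * sqn d v" using assms by auto
    also have "\<dots> \<le> (1 + \<delta>)\<^sup>2 * sqn d v"
      using assms v by (intro mult_right_mono) (auto simp: power2_eq_square)
    finally have "sqrt (sqn t (mat_app t d G v)) \<le> sqrt ((1 + \<delta>)\<^sup>2 * sqn d v)"
      by (rule real_sqrt_le_mono)
    then show "edist t (mat_app t d G u) (mat_app t d G w) \<le> (1 + \<delta>) * edist d u w"
      using assms by (simp add: edist_mat_app edist_eq_sqn[of d] v_def real_sqrt_mult)
  qed
  have lower: "except_prob (gauss_mat t d) (exp (- real t * \<delta>\<^sup>2 / 16))
    (\<lambda>G. (1 - \<delta>) * edist d u w \<le> edist t (mat_app t d G u) (mat_app t d G w))"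
    unfolding except_prob_def
  proof (intro bexI conjI ballI)
    \<comment> \<open>The negative parameter reverses the event. Here
      \<open>ln (1 - x) + x * (1 - \<delta>)\<close> is even at least
      \<open>\<delta>^2 / 4\<close>.\<close>
    note T = gauss_mat_tail[OF assms(1) v, of "- (\<delta>/2)" "1 - \<delta>"]
    let ?A = "{G \<in> space (gauss_mat t d). - (\<delta>/2) * ((1 - \<delta>) * sqn d v) \<le> - (\<delta>/2) * sqn t (mat_app t d G v)}"
    show "?A \<in> events" by (rule T(1)) (use assms in simp)
    have "\<delta>/2 - (\<delta>/2)\<^sup>2 \<le> ln (1 + \<delta>/2)"
      by (rule ln_one_plus_pos_lower_bound) (use assms in auto)
    moreover have "(\<delta>/2 - (\<delta>/2)\<^sup>2) + - (\<delta>/2) * (1 - \<delta>) = \<delta>\<^sup>2 / 4"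
      by (simp add: power2_eq_square field_simps)
    ultimately have "\<delta>\<^sup>2 / 8 \<le> ln (1 - - (\<delta>/2)) + - (\<delta>/2) * (1 - \<delta>)"
      using zero_le_power2[of \<delta>] by (simp only: diff_minus_eq_add)
    then have "(real t / 2) * (\<delta>\<^sup>2 / 8) \<le> (real t / 2) * (ln (1 - - (\<delta>/2)) + - (\<delta>/2) * (1 - \<delta>))"
      by (intro mult_left_mono) auto
    then have "exp (- (real t / 2) * (ln (1 - - (\<delta>/2)) + - (\<delta>/2) * (1 - \<delta>))) \<le> exp (- real t * \<delta>\<^sup>2 / 16)"
      by simp
    then show "prob ?A \<le> exp (- real t * \<delta>\<^sup>2 / 16)"
      by (rule order_trans[rotated]) (rule T(2), use assms in simp)
    fix G assume "G \<in> space (gauss_mat t d) - ?A"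
    then have "\<delta> * ((1 - \<delta>) * sqn d v) \<le> \<delta> * sqn t (mat_app t d G v)" using assms by auto
    then have "(1 - \<delta>) * sqn d v \<le> sqn t (mat_app t d G v)" using assms by simp
    moreover have "(1 - \<delta>)\<^sup>2 * sqn d v \<le> (1 - \<delta>) * sqn d v"
      using assms v by (intro mult_right_mono) (auto simp: power2_eq_square mult_left_le)
    ultimately have "sqrt ((1 - \<delta>)\<^sup>2 * sqn d v) \<le> sqrt (sqn t (mat_app t d G v))"
      by (intro real_sqrt_le_mono) linarith
    then show "(1 - \<delta>) * edist d u w \<le> edist t (mat_app t d G u) (mat_app t d G w)"
      using assms by (simp add: edist_mat_app edist_eq_sqn[of d] v_def real_sqrt_mult)
  qed
  show ?thesis
    using except_prob_conj[OF lower upper] by (simp only: mult_2)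
qed

subsection \<open>Distances\<close>

lemma edist_commute: "edist m x y = edist m y x"
  by (simp add: edist_def power2_commute)

lemma edist_triangle: "edist m x z \<le> edist m x y + edist m y z"
  using L2_set_triangle_ineq[of "\<lambda>i. x i - y i" "\<lambda>i. y i - z i" "{..<m}"]
  by (simp add: edist_def L2_set_def)

lemma edist_self [simp]: "edist m x x = 0"
  by (simp add: edist_def)

lemma edist_eq_0_iff: "x \<in> vecs m \<Longrightarrow> y \<in> vecs m \<Longrightarrow> edist m x y = 0 \<longleftrightarrow> x = y"
  by (auto simp: edist_def vecs_def sum_nonneg_eq_0_iff fun_eq_iff) (metis lessThan_iff not_less)

lemma mat_app_in_vecs: "mat_app t d G x \<in> vecs t"
  by (simp add: vecs_def mat_app_def)

subsection \<open>Minimum enclosing balls\<close>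

text \<open>In this form the variance depends on pairwise differences only, so that variances in
  source and target can be compared.\<close>

lemma weighted_variance:
  fixes l a :: "'a \<Rightarrow> real"
  assumes "(\<Sum>i\<in>I. l i) = 1"
  shows "(\<Sum>i\<in>I. l i * (a i)\<^sup>2) - (\<Sum>i\<in>I. l i * a i)\<^sup>2
    = (\<Sum>i\<in>I. \<Sum>j\<in>I. l i * l j * (a i - a j)\<^sup>2) / 2"
proof -
  have "(\<Sum>i\<in>I. \<Sum>j\<in>I. l i * l j * (a i - a j)\<^sup>2)
     = (\<Sum>i\<in>I. \<Sum>j\<in>I. (l i * (a i)\<^sup>2) * l j + l i * (l j * (a j)\<^sup>2) - 2 * ((l i * a i) * (l j * a j)))"
    by (intro sum.cong refl) (simp add: power2_eq_square algebra_simps)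
  also have "\<dots> = (\<Sum>i\<in>I. l i * (a i)\<^sup>2) * (\<Sum>i\<in>I. l i) + (\<Sum>i\<in>I. l i) * (\<Sum>i\<in>I. l i * (a i)\<^sup>2)
     - 2 * ((\<Sum>i\<in>I. l i * a i) * (\<Sum>i\<in>I. l i * a i))"
    unfolding sum_product by (simp add: sum.distrib sum_subtractf sum_distrib_left)
  finally show ?thesis using assms by (simp add: power2_eq_square)
qed

text \<open>The second moment about \<open>z\<close> exceeds the variance by the squared distance
  from \<open>z\<close> to the mean.\<close>

lemma weighted_variance_le:
  fixes l a :: "'a \<Rightarrow> real"
  assumes "(\<Sum>i\<in>I. l i) = 1"
  shows "(\<Sum>i\<in>I. l i * (a i)\<^sup>2) - (\<Sum>i\<in>I. l i * a i)\<^sup>2 \<le> (\<Sum>i\<in>I. l i * (a i - z)\<^sup>2)"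
proof -
  have "(\<Sum>i\<in>I. l i * (a i - z)\<^sup>2) = (\<Sum>i\<in>I. l i * (a i)\<^sup>2 + z\<^sup>2 * l i - 2 * z * (l i * a i))"
    by (intro sum.cong refl) (simp add: power2_eq_square algebra_simps)
  also have "\<dots> = (\<Sum>i\<in>I. l i * (a i)\<^sup>2) + z\<^sup>2 * (\<Sum>i\<in>I. l i) - 2 * z * (\<Sum>i\<in>I. l i * a i)"
    by (simp add: sum.distrib sum_subtractf sum_distrib_left)
  also have "\<dots> = ((\<Sum>i\<in>I. l i * (a i)\<^sup>2) - (\<Sum>i\<in>I. l i * a i)\<^sup>2) + (z - (\<Sum>i\<in>I. l i * a i))\<^sup>2"
    using assms by (simp add: power2_eq_square algebra_simps)
  finally show ?thesis by simp
qed

text \<open>Weights are total functions that vanish off \<open>I\<close>, which makes the simplex a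
  closed subset of a cube that is compact by Tychonoff's theorem.\<close>

definition simplex_fun :: "'a set \<Rightarrow> ('a \<Rightarrow> real) set" where
  "simplex_fun I = {l. (\<forall>i. 0 \<le> l i) \<and> (\<forall>i. i \<notin> I \<longrightarrow> l i = 0) \<and> sum l I = 1}"

lemma compact_simplex_fun:
  assumes "finite I"
  shows "compact (simplex_fun I)"
proof -
  have "compactin (product_topology (\<lambda>i. euclidean) UNIV) (PiE UNIV (\<lambda>i::'a. {0..1::real}))"
    by (simp add: compactin_PiE)
  then have K: "compact (PiE UNIV (\<lambda>i::'a. {0..1::real}))"
    by (simp add: euclidean_product_topology)
  have "closed {l. sum l I = (1::real)}"
    by (intro closed_Collect_eq continuous_on_sum continuous_on_product_coordinates continuous_on_const)
  moreover have "closed {l :: 'a \<Rightarrow> real. l i = 0}" for i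
    by (intro closed_Collect_eq continuous_on_product_coordinates continuous_on_const)
  then have "closed (\<Inter>i\<in>-I. {l :: 'a \<Rightarrow> real. l i = 0})"
    by (intro closed_INT) auto
  ultimately have "compact (PiE UNIV (\<lambda>i::'a. {0..1::real}) \<inter>
      ({l. sum l I = (1::real)} \<inter> (\<Inter>i\<in>-I. {l :: 'a \<Rightarrow> real. l i = 0})))"
    by (intro compact_Int_closed K closed_Int)
  also have "\<dots> = simplex_fun I"
  proof -
    have "l i \<le> 1" if "\<forall>i. 0 \<le> l i" "\<forall>i. i \<notin> I \<longrightarrow> l i = 0" "sum l I = 1" for l :: "'a \<Rightarrow> real" and i
      using member_le_sum[of i I l] that assms by (cases "i \<in> I") auto
    then show ?thesis
      by (auto simp: simplex_fun_def)
  qed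
  finally show ?thesis .
qed

text \<open>The centre of a minimum enclosing ball is found by duality: for weights maximising the
  weighted variance, the barycentre is within the standard deviation of every point.\<close>

lemma ex_balanced_weights:
  fixes x :: "'a \<Rightarrow> nat \<Rightarrow> real"
  assumes "finite I" "I \<noteq> {}"
  obtains l where "l \<in> simplex_fun I"
    "\<And>j. j \<in> I \<Longrightarrow> (\<Sum>q<d. (x j q - (\<Sum>i\<in>I. l i * x i q))\<^sup>2)
       \<le> (\<Sum>q<d. (\<Sum>i\<in>I. l i * (x i q)\<^sup>2) - (\<Sum>i\<in>I. l i * x i q)\<^sup>2)"
proof -
  define f where "f l = (\<Sum>q<d. (\<Sum>i\<in>I. l i * (x i q)\<^sup>2) - (\<Sum>i\<in>I. l i * x i q)\<^sup>2)" for l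
  obtain i0 where "i0 \<in> I" using assms by auto
  then have "(\<lambda>i. if i = i0 then 1 else 0) \<in> simplex_fun I"
    using assms by (auto simp: simplex_fun_def)
  moreover have "continuous_on (simplex_fun I) f"
    unfolding f_def
    by (intro continuous_intros continuous_on_subset[OF continuous_on_product_coordinates]) auto
  ultimately obtain l where l: "l \<in> simplex_fun I" "\<And>l'. l' \<in> simplex_fun I \<Longrightarrow> f l' \<le> f l"
    using continuous_attains_sup[OF compact_simplex_fun[OF assms(1)], of f] by auto
  define c where "c q = (\<Sum>i\<in>I. l i * x i q)" for q
  show ?thesis
  proof (rule that[OF l(1)])
    fix j assume j: "j \<in> I"
    define D where "D = (\<Sum>q<d. (x j q - c q)\<^sup>2)"
    \<comment> \<open>Scaling the weights by \<open>1 - s\<close> and adding \<open>s\<close> at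
      \<open>j\<close> changes the variance to \<open>(1 - s) * f l + s * (1 - s) * D\<close>.
      Maximality of \<open>l\<close> bounds this by \<open>f l\<close>; afterwards \<open>s\<close>
      tends to zero.\<close>
    have step: "(1 - s) * D \<le> f l" if s: "0 < s" "s < 1" for s
    proof -
      define l' where "l' i = (1 - s) * l i + (if i = j then s else 0)" for i
      have lin: "(\<Sum>i\<in>I. l' i * g i) = (1 - s) * (\<Sum>i\<in>I. l i * g i) + s * g j" for g
      proof -
        have "(\<Sum>i\<in>I. l' i * g i) = (\<Sum>i\<in>I. (1 - s) * (l i * g i) + (if i = j then s * g i else 0))"
          by (intro sum.cong) (auto simp: l'_def algebra_simps)
        also have "\<dots> = (1 - s) * (\<Sum>i\<in>I. l i * g i) + s * g j"
          using j assms by (simp add: sum.distrib sum_distrib_left)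
        finally show ?thesis .
      qed
      have "l' \<in> simplex_fun I"
        using l(1) s j lin[of "\<lambda>_. 1"] by (auto simp: simplex_fun_def l'_def[abs_def])
      then have "f l' \<le> f l" by (rule l)
      moreover have "f l' = (1 - s) * f l + s * (1 - s) * D"
      proof -
        have alg: "((1 - s) * A + s * a\<^sup>2) - ((1 - s) * m + s * a)\<^sup>2
            = (1 - s) * (A - m\<^sup>2) + s * (1 - s) * (a - m)\<^sup>2" for A m a :: real
          by (simp add: power2_eq_square algebra_simps)
        show ?thesis
          unfolding f_def D_def lin c_def[symmetric] alg
          by (simp only: sum.distrib sum_distrib_left)
      qed
      ultimately have "s * ((1 - s) * D) \<le> s * f l" by (simp add: algebra_simps)
      then show ?thesis using s by simp
    qed
    have "((\<lambda>s. (1 - s) * D) \<longlongrightarrow> (1 - 0) * D) (at_right 0)"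
      by (intro tendsto_intros)
    moreover have "eventually (\<lambda>s::real. (1 - s) * D \<le> f l) (at_right 0)"
      using eventually_at_right_less[of "0::real"] eventually_at_right_field[of "\<lambda>s. s < 1" "0::real"]
      by (auto intro!: eventually_at_rightI[of 0 1] step)
    ultimately have "(1 - 0) * D \<le> f l"
      by (intro tendsto_upperbound) auto
    then show "(\<Sum>q<d. (x j q - (\<Sum>i\<in>I. l i * x i q))\<^sup>2)
       \<le> (\<Sum>q<d. (\<Sum>i\<in>I. l i * (x i q)\<^sup>2) - (\<Sum>i\<in>I. l i * x i q)\<^sup>2)"
      by (simp add: D_def f_def c_def)
  qed
qed

text \<open>For balanced weights, the squared distances from the points \<open>x\<close> to their
  barycentre are at most the variance of \<open>x\<close>. Comparing pairwise distances bounds this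
  by \<open>L^2\<close> times the variance of \<open>y\<close>, which is at most the second moment
  of \<open>y\<close> about \<open>z\<close>, hence at most \<open>r^2\<close>.\<close>

lemma enclosing_ball_lipschitz:
  fixes x y :: "'a \<Rightarrow> nat \<Rightarrow> real"
  assumes "finite I" "I \<noteq> {}" and x: "\<And>i. i \<in> I \<Longrightarrow> x i \<in> vecs d"
    and lip: "\<And>i j. i \<in> I \<Longrightarrow> j \<in> I \<Longrightarrow> edist d (x i) (x j) \<le> L * edist t (y i) (y j)"
    and z: "\<And>i. i \<in> I \<Longrightarrow> edist t (y i) z \<le> r"
    and "L \<ge> 0" "r \<ge> 0"
  obtains c where "c \<in> vecs d" "\<And>i. i \<in> I \<Longrightarrow> edist d (x i) c \<le> L * r"
proof -
  obtain l where l: "l \<in> simplex_fun I"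
    "\<And>j. j \<in> I \<Longrightarrow> (\<Sum>q<d. (x j q - (\<Sum>i\<in>I. l i * x i q))\<^sup>2)
       \<le> (\<Sum>q<d. (\<Sum>i\<in>I. l i * (x i q)\<^sup>2) - (\<Sum>i\<in>I. l i * x i q)\<^sup>2)"
    using ex_balanced_weights[OF assms(1,2), of x d] by blast
  have l0: "l i \<ge> 0" for i using l(1) by (simp add: simplex_fun_def)
  have l1: "sum l I = 1" using l(1) by (simp add: simplex_fun_def)
  have sq: "(edist m a b)\<^sup>2 = (\<Sum>q<m. (a q - b q)\<^sup>2)" for m a b
    by (simp add: edist_def sum_nonneg)
  have V: "(\<Sum>q<m. (\<Sum>i\<in>I. l i * (w i q)\<^sup>2) - (\<Sum>i\<in>I. l i * w i q)\<^sup>2)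
      = (\<Sum>i\<in>I. \<Sum>j\<in>I. l i * l j * (edist m (w i) (w j))\<^sup>2) / 2" for m and w :: "'a \<Rightarrow> nat \<Rightarrow> real"
    unfolding weighted_variance[OF l1] sq sum_distrib_left sum_divide_distrib[symmetric]
    by (subst sum.swap, rule arg_cong[where f = "\<lambda>a. a / 2"], rule sum.cong[OF refl], rule sum.swap)
  define c where "c q = (\<Sum>i\<in>I. l i * x i q)" for q
  show ?thesis
  proof (rule that)
    show "c \<in> vecs d" using x by (auto simp: vecs_def c_def)
    fix j assume j: "j \<in> I"
    have "(edist d (x j) c)\<^sup>2 \<le> (\<Sum>q<d. (\<Sum>i\<in>I. l i * (x i q)\<^sup>2) - (\<Sum>i\<in>I. l i * x i q)\<^sup>2)"
      unfolding sq c_def by (rule l(2)[OF j])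
    also have "\<dots> = (\<Sum>i\<in>I. \<Sum>j\<in>I. l i * l j * (edist d (x i) (x j))\<^sup>2) / 2" by (rule V)
    also have "\<dots> \<le> (\<Sum>i\<in>I. \<Sum>j\<in>I. l i * l j * (L * edist t (y i) (y j))\<^sup>2) / 2"
      by (intro divide_right_mono sum_mono mult_left_mono power_mono lip mult_nonneg_nonneg l0 edist_nonneg) auto
    also have "\<dots> = L\<^sup>2 * ((\<Sum>i\<in>I. \<Sum>j\<in>I. l i * l j * (edist t (y i) (y j))\<^sup>2) / 2)"
      by (simp add: power_mult_distrib sum_distrib_left algebra_simps)
    also have "\<dots> = L\<^sup>2 * (\<Sum>q<t. (\<Sum>i\<in>I. l i * (y i q)\<^sup>2) - (\<Sum>i\<in>I. l i * y i q)\<^sup>2)"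
      unfolding V ..
    also have "\<dots> \<le> L\<^sup>2 * (\<Sum>q<t. \<Sum>i\<in>I. l i * (y i q - z q)\<^sup>2)"
      by (intro mult_left_mono sum_mono weighted_variance_le l1) auto
    also have "(\<Sum>q<t. \<Sum>i\<in>I. l i * (y i q - z q)\<^sup>2) = (\<Sum>i\<in>I. l i * (edist t (y i) z)\<^sup>2)"
      unfolding sq sum_distrib_left by (rule sum.swap)
    also have "L\<^sup>2 * \<dots> \<le> L\<^sup>2 * (\<Sum>i\<in>I. l i * r\<^sup>2)"
      by (intro mult_left_mono sum_mono power_mono z l0 edist_nonneg) auto
    also have "\<dots> = (L * r)\<^sup>2"
      by (simp add: sum_distrib_right[symmetric] l1 power_mult_distrib)
    finally show "edist d (x j) c \<le> L * r"
      by (rule power2_le_imp_le) (use \<open>L \<ge> 0\<close> \<open>r \<ge> 0\<close> in simp)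
  qed
qed

subsection \<open>Doubling dimension and nets\<close>

text \<open>The covering number is kept instead of its logarithm because repeated halving multiplies
  it.\<close>

definition doubling :: "nat \<Rightarrow> (nat \<Rightarrow> real) set \<Rightarrow> real \<Rightarrow> bool" where
  "doubling m P L \<longleftrightarrow> (\<forall>x\<in>P. \<forall>r>0. \<exists>S. S \<subseteq> P \<and> finite S \<and> real (card S) \<le> L \<and>
     cballP m P x r \<subseteq> (\<Union>s\<in>S. cballP m P s (r/2)))"

lemma ddim_alt: "ddim m P = Inf {D. 0 \<le> D \<and> doubling m P (2 powr D)}"
  by (simp add: ddim_def doubling_def)

lemma doubling_card:
  assumes "finite P"
  shows "doubling m P (real (card P))"
  unfolding doubling_def
  by (intro ballI allI impI exI[of _ P]) (use assms in \<open>auto simp: cballP_def intro: bexI\<close>)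

text \<open>The infimum in \<open>ddim\<close> is meaningful only over a nonempty set; taking every
  point as a centre makes \<open>log 2 (card P)\<close> admissible.\<close>

lemma doubling_exponents_nonempty:
  assumes "finite P" "P \<noteq> {}"
  shows "{D. 0 \<le> D \<and> doubling m P (2 powr D)} \<noteq> {}"
proof -
  have "card P \<ge> 1" using assms by (simp add: Suc_leI card_gt_0_iff)
  then have "0 \<le> log 2 (card P) \<and> doubling m P (2 powr log 2 (card P))"
    using doubling_card[OF assms(1), of m] by simp
  then show ?thesis by blast
qed

lemma ddim_nonneg: "finite P \<Longrightarrow> P \<noteq> {} \<Longrightarrow> 0 \<le> ddim m P"
  unfolding ddim_alt by (rule cInf_greatest[OF doubling_exponents_nonempty]) auto

text \<open>A ball around one of two points at minimal distance cannot be covered by a single ball of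
  half the radius.\<close>

lemma ddim_ge_1:
  assumes "finite P" "P \<subseteq> vecs m" "card P \<ge> 2"
  shows "1 \<le> ddim m P"
  unfolding ddim_alt
proof (rule cInf_greatest[OF doubling_exponents_nonempty])
  show "P \<noteq> {}" using assms by auto
  fix D assume "D \<in> {D. 0 \<le> D \<and> doubling m P (2 powr D)}"
  then have D: "0 \<le> D" "doubling m P (2 powr D)" by auto
  define E where "E = {(x, y). x \<in> P \<and> y \<in> P \<and> x \<noteq> y}"
  have "finite E" by (rule finite_subset[of _ "P \<times> P"]) (auto simp: E_def assms)
  moreover have "E \<noteq> {}"
    using assms card_le_Suc0_iff_eq[of P] by (fastforce simp: E_def)
  ultimately have "Min ((\<lambda>(x,y). edist m x y) ` E) \<in> (\<lambda>(x,y). edist m x y) ` E"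
    by (intro Min_in) auto
  then obtain x y where xy: "(x,y) \<in> E" "edist m x y = Min ((\<lambda>(x,y). edist m x y) ` E)"
    by auto
  have min: "edist m x y \<le> edist m u v" if "u \<in> P" "v \<in> P" "u \<noteq> v" for u v
    unfolding xy(2) using \<open>finite E\<close> that by (intro Min_le) (auto simp: E_def)
  have P: "x \<in> P" "y \<in> P" "x \<noteq> y" using xy by (auto simp: E_def)
  then have pos: "edist m x y > 0"
    using edist_eq_0_iff[of x m y] edist_nonneg[of m x y] assms(2) by force
  obtain S where S: "S \<subseteq> P" "finite S" "real (card S) \<le> 2 powr D"
      "cballP m P x (edist m x y) \<subseteq> (\<Union>s\<in>S. cballP m P s (edist m x y / 2))"
    using D(2)[unfolded doubling_def, rule_format, OF P(1) pos] by (elim exE conjE)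
  have "u \<in> S" if "u \<in> P" "edist m x u \<le> edist m x y" for u
  proof -
    from that S(4) obtain s where s: "s \<in> S" "edist m s u \<le> edist m x y / 2"
      by (auto simp: cballP_def)
    then have "s = u" using min[of s u] pos that S(1) by force
    then show ?thesis using s by simp
  qed
  then have "{x, y} \<subseteq> S" using P edist_nonneg[of m x y] by auto
  then have "2 \<le> card S" using P(3) S(2) card_mono[of S "{x,y}"] by auto
  then have "2 powr 1 \<le> 2 powr D" using S(3) by simp
  then show "1 \<le> D" by (subst (asm) powr_le_cancel_iff) auto
qed (fact assms)

text \<open>This avoids asking whether the infimum is attained: some admissible exponent lies below
  twice a positive \<open>ddim\<close>, and admissibility is monotone. The factor 2 only affects
  constants.\<close>

lemma doubling_2_ddim:
  assumes "finite P" "P \<noteq> {}" "0 < ddim m P"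
  shows "doubling m P (2 powr (2 * ddim m P))"
proof -
  have "Inf {D. 0 \<le> D \<and> doubling m P (2 powr D)} < 2 * ddim m P"
    using assms(3) by (simp flip: ddim_alt)
  then obtain D where D: "0 \<le> D" "doubling m P (2 powr D)" "D < 2 * ddim m P"
    using cInf_lessD[OF doubling_exponents_nonempty[OF assms(1,2)]] by auto
  have "2 powr D \<le> 2 powr (2 * ddim m P)" using D by simp
  then show ?thesis using D(2) unfolding doubling_def by (meson order_trans)
qed

lemma cover_iterate:
  assumes "doubling m P L" "L \<ge> 0" "x \<in> P" "r > 0"
  shows "\<exists>S. S \<subseteq> P \<and> finite S \<and> real (card S) \<le> L ^ n \<and>
     cballP m P x r \<subseteq> (\<Union>s\<in>S. cballP m P s (r / 2 ^ n))"
proof (induction n)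
  case 0
  then show ?case by (intro exI[of _ "{x}"]) (use assms in auto)
next
  case (Suc n)
  then obtain S where S: "S \<subseteq> P" "finite S" "real (card S) \<le> L ^ n"
      "cballP m P x r \<subseteq> (\<Union>s\<in>S. cballP m P s (r / 2 ^ n))" by blast
  have "\<forall>s\<in>S. \<exists>T. T \<subseteq> P \<and> finite T \<and> real (card T) \<le> L \<and>
     cballP m P s (r / 2 ^ n) \<subseteq> (\<Union>u\<in>T. cballP m P u (r / 2 ^ n / 2))"
  proof
    fix s assume "s \<in> S"
    then have "s \<in> P" "r / 2 ^ n > 0" using S(1) assms(4) by auto
    from assms(1)[unfolded doubling_def, rule_format, OF this]
    show "\<exists>T. T \<subseteq> P \<and> finite T \<and> real (card T) \<le> L \<and>
      cballP m P s (r / 2 ^ n) \<subseteq> (\<Union>u\<in>T. cballP m P u (r / 2 ^ n / 2))" .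
  qed
  from bchoice[OF this] obtain T where T: "\<forall>s\<in>S. T s \<subseteq> P \<and> finite (T s) \<and> real (card (T s)) \<le> L \<and>
     cballP m P s (r / 2 ^ n) \<subseteq> (\<Union>u\<in>T s. cballP m P u (r / 2 ^ n / 2))" ..
  have "real (card (\<Union>s\<in>S. T s)) \<le> (\<Sum>s\<in>S. real (card (T s)))"
    using card_UN_le[OF S(2), of T] by (simp flip: of_nat_sum)
  also have "\<dots> \<le> real (card S) * L"
    using T by (intro sum_bounded_above) auto
  also have "\<dots> \<le> L ^ n * L"
    using S(3) assms(2) by (rule mult_right_mono)
  finally have "real (card (\<Union>s\<in>S. T s)) \<le> L ^ Suc n" by (simp add: mult.commute)
  moreover have "r / 2 ^ n / 2 = r / 2 ^ Suc n" by simp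
  moreover have "cballP m P x r \<subseteq> (\<Union>u\<in>(\<Union>s\<in>S. T s). cballP m P u (r / 2 ^ n / 2))"
  proof
    fix z assume "z \<in> cballP m P x r"
    from subsetD[OF S(4) this] obtain s where s: "s \<in> S" "z \<in> cballP m P s (r / 2 ^ n)" by (rule UN_E)
    with T have "z \<in> (\<Union>u\<in>T s. cballP m P u (r / 2 ^ n / 2))" by (meson subsetD)
    then show "z \<in> (\<Union>u\<in>(\<Union>s\<in>S. T s). cballP m P u (r / 2 ^ n / 2))" using s(1) by auto
  qed
  moreover have "(\<Union>s\<in>S. T s) \<subseteq> P" "finite (\<Union>s\<in>S. T s)"
    using T S(2) by auto
  ultimately show ?case
    by (intro exI[of _ "\<Union>s\<in>S. T s"]) (simp only: simp_thms)
qed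

text \<open>The centres \<open>C\<close> need not lie in \<open>P\<close>, whereas doubling concerns
  balls about points of \<open>P\<close>. So a nonempty cluster is first enclosed in a ball of
  radius \<open>2 * R\<close> about one of its own points, which is then halved \<open>n\<close>
  times.\<close>

lemma ex_net_of_clusters:
  assumes "doubling m P L" "L \<ge> 0" "finite C" "R > 0"
    and near: "\<And>x. x \<in> P \<Longrightarrow> \<exists>c\<in>C. edist m x c \<le> R"
  obtains N where "N \<subseteq> P" "finite N" "real (card N) \<le> real (card C) * L ^ n"
    "\<And>x. x \<in> P \<Longrightarrow> \<exists>y\<in>N. edist m y x \<le> 2 * R / 2 ^ n"
proof -
  have "\<exists>S. S \<subseteq> P \<and> finite S \<and> real (card S) \<le> L ^ n \<and>
     {x\<in>P. edist m x c \<le> R} \<subseteq> (\<Union>s\<in>S. cballP m P s (2 * R / 2 ^ n))" for c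
  proof (cases "{x\<in>P. edist m x c \<le> R} = {}")
    case True
    then show ?thesis using assms(2) by (intro exI[of _ "{}"]) (simp only: finite.emptyI card.empty, simp)
  next
    case False
    then obtain p where p: "p \<in> P" "edist m p c \<le> R" by blast
    have "{x\<in>P. edist m x c \<le> R} \<subseteq> cballP m P p (2 * R)"
    proof
      fix x assume "x \<in> {x\<in>P. edist m x c \<le> R}"
      then show "x \<in> cballP m P p (2 * R)"
        using edist_triangle[of m p x c] p edist_commute[of m x c] by (auto simp: cballP_def)
    qed
    moreover obtain S where "S \<subseteq> P" "finite S" "real (card S) \<le> L ^ n"
        "cballP m P p (2 * R) \<subseteq> (\<Union>s\<in>S. cballP m P s (2 * R / 2 ^ n))"
      using cover_iterate[OF assms(1,2) p(1), of "2 * R" n] \<open>R > 0\<close> by auto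
    ultimately show ?thesis
      by (intro exI[of _ S] conjI) (assumption | rule subset_trans)+
  qed
  then have "\<forall>c. \<exists>S. S \<subseteq> P \<and> finite S \<and> real (card S) \<le> L ^ n \<and>
     {x\<in>P. edist m x c \<le> R} \<subseteq> (\<Union>s\<in>S. cballP m P s (2 * R / 2 ^ n))" by (rule allI)
  from choice[OF this] obtain S where S: "\<forall>c. S c \<subseteq> P \<and> finite (S c) \<and> real (card (S c)) \<le> L ^ n \<and>
     {x\<in>P. edist m x c \<le> R} \<subseteq> (\<Union>s\<in>S c. cballP m P s (2 * R / 2 ^ n))" ..
  show ?thesis
  proof (rule that[of "\<Union>c\<in>C. S c"])
    have "real (card (\<Union>c\<in>C. S c)) \<le> (\<Sum>c\<in>C. real (card (S c)))"
      using card_UN_le[OF assms(3), of S] by (simp flip: of_nat_sum)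
    also have "\<dots> \<le> real (card C) * L ^ n"
      using S by (intro sum_bounded_above) auto
    finally show "real (card (\<Union>c\<in>C. S c)) \<le> real (card C) * L ^ n" .
    fix x assume "x \<in> P"
    then obtain c where "c \<in> C" "edist m x c \<le> R" using near by blast
    then have "x \<in> {x\<in>P. edist m x c \<le> R}" using \<open>x \<in> P\<close> by simp
    then have "x \<in> (\<Union>s\<in>S c. cballP m P s (2 * R / 2 ^ n))" using S by (meson subsetD)
    then show "\<exists>y\<in>\<Union>c\<in>C. S c. edist m y x \<le> 2 * R / 2 ^ n"
      using \<open>c \<in> C\<close> by (auto simp: cballP_def)
  qed (use S assms(3) in auto)
qed

subsection \<open>Chaining\<close>

text \<open>Induction on the scale: cover the ball by balls of radius \<open>r/2\<close>. The displacements of their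
  centres are expanded by at most \<open>(a - 1)/3\<close>, the smaller balls by at most \<open>a + 1\<close>, and
  \<open>(3/2) (a - 1)/3 + (a + 1)/2 = a\<close>. The gain from \<open>a\<close> to \<open>a + 1\<close> in the exponent pays for the union
  bound; \<open>a \<ge> 40\<close> makes the tail at \<open>(a - 1)/3\<close> smaller than \<open>exp (- t (a + 1))\<close>.\<close>

lemma except_prob_ball_expansion:
  assumes "t \<ge> 1" and dbl: "doubling d P L" and L: "L \<ge> 0" "L * 2 * exp (- real t) \<le> 1"
  shows "y \<in> P \<Longrightarrow> r > 0 \<Longrightarrow> a \<ge> 40 \<Longrightarrow>
    (\<And>u w. u \<in> P \<Longrightarrow> w \<in> P \<Longrightarrow> edist d u w \<le> r / 2 ^ n \<Longrightarrow> edist d u w = 0) \<Longrightarrow>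
    except_prob (gauss_mat t d) (exp (- real t * a))
      (\<lambda>G. \<forall>x\<in>cballP d P y r. edist t (mat_app t d G y) (mat_app t d G x) \<le> a * r)"
proof (induction n arbitrary: y r a)
  case 0
  have "edist t (mat_app t d G y) (mat_app t d G x) \<le> a * r" if "x \<in> cballP d P y r" for x G
  proof -
    have "edist d y x = 0" using 0 that by (auto simp: cballP_def)
    then show ?thesis using 0 by (simp add: edist_mat_app edist_eq_sqn[of d] sqn_mat_app_0)
  qed
  then show ?case by (intro except_prob_always) auto
next
  case (Suc n)
  interpret prob_space "gauss_mat t d" by (rule prob_space_gauss_mat)
  define b where "b = (a - 1) / 3"
  obtain S where S: "S \<subseteq> P" "finite S" "real (card S) \<le> L"
      "cballP d P y r \<subseteq> (\<Union>s\<in>S. cballP d P s (r/2))"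
    using dbl[unfolded doubling_def, rule_format, OF Suc.prems(1,2)] by (elim exE conjE)
  \<comment> \<open>Each of the at most \<open>L\<close> centres brings two events of failure
    probability \<open>?p\<close>, and \<open>2 * L * exp (- t) <= 1\<close> reduces their sum to
    \<open>exp (- t * a)\<close>.\<close>
  let ?p = "exp (- real t * (a + 1))"
  have centre: "except_prob (gauss_mat t d) ?p
      (\<lambda>G. edist t (mat_app t d G y) (mat_app t d G s) \<le> b * edist d y s)" for s
  proof (rule except_prob_mono[OF except_prob_expansion[OF \<open>t \<ge> 1\<close>]])
    show "b \<ge> 0" using Suc.prems by (simp add: b_def)
    \<comment> \<open>Multiplied by 36, the wanted inequality reads
      \<open>a^2 - 38 * a - 47.6 >= 0\<close>, and this product is
      \<open>a^2 - 38 * a - 80\<close>.\<close>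
    have "(a - 40) * (a + 2) \<ge> 0" using Suc.prems by simp
    then have "a + 1 \<le> b\<^sup>2 / 4 - 7/20"
      using Suc.prems by (simp add: b_def power2_eq_square field_simps)
    then show "exp (- real t * (b\<^sup>2 / 4 - 7/20)) \<le> ?p"
      by (simp add: mult_left_mono)
  qed
  have inner: "except_prob (gauss_mat t d) ?p
      (\<lambda>G. \<forall>x\<in>cballP d P s (r/2). edist t (mat_app t d G s) (mat_app t d G x) \<le> (a + 1) * (r/2))"
    if "s \<in> S" for s
    using that S(1) Suc.prems(2,3) by (intro Suc.IH Suc.prems(4)) auto
  have "except_prob (gauss_mat t d) (real (card S) * (?p + ?p))
     (\<lambda>G. \<forall>s\<in>S. edist t (mat_app t d G y) (mat_app t d G s) \<le> b * edist d y s \<and>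
        (\<forall>x\<in>cballP d P s (r/2). edist t (mat_app t d G s) (mat_app t d G x) \<le> (a + 1) * (r/2)))"
    by (intro except_prob_ball except_prob_conj centre inner S(2))
  then show ?case
  proof (rule except_prob_mono)
    have "real (card S) * (?p + ?p) = (real (card S) * 2 * exp (- real t)) * exp (- real t * a)"
      by (simp add: distrib_left exp_add exp_diff exp_minus field_simps)
    also have "\<dots> \<le> 1 * exp (- real t * a)"
    proof (intro mult_right_mono)
      have "real (card S) * 2 * exp (- real t) \<le> L * 2 * exp (- real t)"
        using S(3) by (intro mult_right_mono) auto
      then show "real (card S) * 2 * exp (- real t) \<le> 1" using L(2) by (rule order_trans)
    qed simp
    finally show "real (card S) * (?p + ?p) \<le> exp (- real t * a)" by simp
  next
    fix G assume G: "\<forall>s\<in>S. edist t (mat_app t d G y) (mat_app t d G s) \<le> b * edist d y s \<and>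
        (\<forall>x\<in>cballP d P s (r/2). edist t (mat_app t d G s) (mat_app t d G x) \<le> (a + 1) * (r/2))"
    show "\<forall>x\<in>cballP d P y r. edist t (mat_app t d G y) (mat_app t d G x) \<le> a * r"
    proof
      fix x assume x: "x \<in> cballP d P y r"
      then obtain s where s: "s \<in> S" "x \<in> cballP d P s (r/2)" using subsetD[OF S(4)] by blast
      \<comment> \<open>The centre \<open>s\<close> may lie outside the ball about \<open>y\<close>,
        so its distance is bounded through \<open>x\<close>.\<close>
      have "edist d y s \<le> r + r/2"
        using edist_triangle[of d y s x] edist_commute[of d x s] x s by (auto simp: cballP_def)
      then have "b * edist d y s \<le> b * (r + r/2)"
        using Suc.prems by (intro mult_left_mono) (auto simp: b_def)
      then have "edist t (mat_app t d G y) (mat_app t d G s) \<le> b * (r + r/2)"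
        using G s by force
      moreover have "edist t (mat_app t d G s) (mat_app t d G x) \<le> (a + 1) * (r/2)"
        using G s by blast
      ultimately have "edist t (mat_app t d G y) (mat_app t d G x) \<le> b * (r + r/2) + (a + 1) * (r/2)"
        using edist_triangle[of t "mat_app t d G y" "mat_app t d G x" "mat_app t d G s"] by linarith
      also have "\<dots> = a * r" by (simp add: b_def field_simps)
      finally show "edist t (mat_app t d G y) (mat_app t d G x) \<le> a * r" .
    qed
  qed
qed

text \<open>A finite set has a least positive distance, which halving eventually undercuts. This is
  the depth at which the chaining stops.\<close>

lemma finite_separated:
  assumes "finite P" "r > 0"
  obtains n where "\<And>u w. u \<in> P \<Longrightarrow> w \<in> P \<Longrightarrow> edist d u w \<le> r / 2 ^ n \<Longrightarrow> edist d u w = 0"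
proof -
  define E where "E = (\<lambda>(u,w). edist d u w) ` (P \<times> P) - {0}"
  have "finite E" using assms by (simp add: E_def)
  have pos: "e > 0" if "e \<in> E" for e
    using that edist_nonneg[of d] by (force simp: E_def less_le)
  have "\<exists>n. \<forall>e\<in>E. r / 2 ^ n < e"
  proof -
    define m where "m = Min (insert 1 E)"
    have m: "m > 0" "\<And>e. e \<in> E \<Longrightarrow> m \<le> e" using \<open>finite E\<close> pos by (auto simp: m_def)
    obtain n where "(1/2) ^ n < m / r" using real_arch_pow_inv[of "m / r" "1/2"] m assms by auto
    then have "r / 2 ^ n < m" using assms by (simp add: field_simps power_one_over)
    then show ?thesis using m(2) by (meson less_le_trans)
  qed
  then obtain n where n: "\<And>e. e \<in> E \<Longrightarrow> r / 2 ^ n < e" by blast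
  show ?thesis
  proof (rule that[of n])
    fix u w assume "u \<in> P" "w \<in> P" "edist d u w \<le> r / 2 ^ n"
    then show "edist d u w = 0" using n[of "edist d u w"] by (fastforce simp: E_def)
  qed
qed

subsection \<open>The k-center value\<close>

lemma kcost_le_iff:
  assumes "finite X" "X \<noteq> {}" "finite C" "C \<noteq> {}"
  shows "kcost m X C \<le> r \<longleftrightarrow> (\<forall>x\<in>X. \<exists>c\<in>C. edist m x c \<le> r)"
  using assms by (simp add: kcost_def Min_le_iff)

lemma kcost_nonneg:
  assumes "finite X" "X \<noteq> {}" "finite C" "C \<noteq> {}"
  shows "0 \<le> kcost m X C"
proof -
  obtain x where "x \<in> X" using assms by auto
  moreover have "\<forall>x\<in>X. \<exists>c\<in>C. edist m x c \<le> kcost m X C"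
    using kcost_le_iff[OF assms, of m "kcost m X C"] by simp
  ultimately show ?thesis using edist_nonneg order_trans by metis
qed

lemma opt_vanilla_le_kcost:
  assumes "finite X" "X \<noteq> {}" "k \<ge> 1" "C \<subseteq> vecs m" "finite C" "card C = k"
  shows "opt_vanilla m k X \<le> kcost m X C"
  unfolding opt_vanilla_def
  by (rule cINF_lower) (use assms in \<open>auto intro!: bdd_belowI2[of _ 0] kcost_nonneg\<close>)

lemma infinite_vecs:
  assumes "m \<ge> 1"
  shows "infinite (vecs m)"
proof
  assume "finite (vecs m)"
  then have "finite ((\<lambda>x. x 0) ` vecs m)" by simp
  moreover have "(\<lambda>x. x 0) ` vecs m = UNIV"
  proof -
    have "a \<in> (\<lambda>x. x 0) ` vecs m" for a :: real
      by (rule image_eqI[of _ _ "\<lambda>i. if i = 0 then a else 0"]) (use assms in \<open>auto simp: vecs_def\<close>)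
    then show ?thesis by blast
  qed
  ultimately show False using infinite_UNIV_char_0 by metis
qed

text \<open>\<open>opt_vanilla\<close> asks for exactly \<open>k\<close> centres, so a smaller set
  is padded with arbitrary vectors. Dimension 0 has a single vector and nothing to pad with, hence
  the alternative in the hypotheses.\<close>

lemma opt_vanilla_le:
  assumes "finite X" "X \<noteq> {}" "m \<ge> 1 \<or> card C = k" "C \<subseteq> vecs m" "finite C" "C \<noteq> {}" "card C \<le> k"
    and "\<And>x. x \<in> X \<Longrightarrow> \<exists>c\<in>C. edist m x c \<le> r"
  shows "opt_vanilla m k X \<le> r"
proof -
  obtain C' where C': "C \<subseteq> C'" "C' \<subseteq> vecs m" "finite C'" "card C' = k"
  proof (cases "card C = k")
    case False
    then have "infinite (vecs m - C)" using assms infinite_vecs by simp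
    then obtain B where B: "B \<subseteq> vecs m - C" "finite B" "card B = k - card C"
      using infinite_arbitrarily_large by blast
    show ?thesis
      by (rule that[of "C \<union> B"]) (use B assms in \<open>auto simp: card_Un_disjoint Int_commute disjoint_iff subset_iff\<close>)
  qed (use assms that in auto)
  have "k \<ge> 1" using assms(5-7) by (simp add: Suc_leI card_gt_0_iff order.trans[of _ "card C"])
  then have "opt_vanilla m k X \<le> kcost m X C'"
    using C' assms by (intro opt_vanilla_le_kcost) auto
  also have "\<dots> \<le> r"
    using assms C' by (subst kcost_le_iff) blast+
  finally show ?thesis .
qed

lemma ex_centers:
  assumes "m \<ge> 1 \<or> k = 1"
  shows "{C. C \<subseteq> vecs m \<and> finite C \<and> card C = k} \<noteq> {}"
proof (cases "m \<ge> 1")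
  case True
  then show ?thesis using infinite_arbitrarily_large[OF infinite_vecs, of m k] by auto
next
  case False
  then have "k = 1" "(\<lambda>_. 0) \<in> vecs m" using assms by (auto simp: vecs_def)
  then show ?thesis by (auto intro!: exI[of _ "{\<lambda>_. 0}"])
qed

lemma opt_vanilla_nonneg:
  assumes "finite X" "X \<noteq> {}" "k \<ge> 1" "m \<ge> 1 \<or> k = 1"
  shows "0 \<le> opt_vanilla m k X"
  unfolding opt_vanilla_def
  by (rule cINF_greatest[OF ex_centers[OF assms(4)]]) (use assms in \<open>auto intro!: kcost_nonneg\<close>)

lemma card_le_1_if_dim_0:
  assumes "P \<subseteq> vecs 0"
  shows "card P \<le> 1"
proof -
  have "P \<subseteq> {\<lambda>_. 0}" using assms by (auto simp: vecs_def)
  then show ?thesis using card_mono[of "{\<lambda>_. 0 :: real}" P] by simp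
qed

text \<open>Pigeonhole: two points share a centre, so their distance is at most twice the cost.
  Positivity allows near-optimality to be measured by a factor.\<close>

lemma opt_vanilla_pos:
  assumes "finite P" "P \<subseteq> vecs m" "1 \<le> k" "k < card P"
  shows "0 < opt_vanilla m k P"
proof -
  have ne: "P \<noteq> {}" using assms by auto
  have m: "m \<ge> 1" using card_le_1_if_dim_0[of P] assms by (cases m) auto
  obtain n where n: "\<And>u w. u \<in> P \<Longrightarrow> w \<in> P \<Longrightarrow> edist m u w \<le> 1 / 2 ^ n \<Longrightarrow> edist m u w = 0"
    using finite_separated[OF assms(1), of 1 m] by auto
  have "1 / 2 ^ Suc n \<le> opt_vanilla m k P"
    unfolding opt_vanilla_def
  proof (rule cINF_greatest[OF ex_centers])
    show "m \<ge> 1 \<or> k = 1" using m by simp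
    fix C assume "C \<in> {C. C \<subseteq> vecs m \<and> finite C \<and> card C = k}"
    then have C: "finite C" "card C = k" "C \<noteq> {}" using assms(3) by auto
    show "1 / 2 ^ Suc n \<le> kcost m P C"
    proof (rule ccontr)
      assume small: "\<not> 1 / 2 ^ Suc n \<le> kcost m P C"
      have "\<forall>x\<in>P. \<exists>c\<in>C. edist m x c \<le> kcost m P C"
        using kcost_le_iff[OF assms(1) ne C(1,3), of m "kcost m P C"] by simp
      then obtain f where f: "\<And>x. x \<in> P \<Longrightarrow> f x \<in> C" "\<And>x. x \<in> P \<Longrightarrow> edist m x (f x) \<le> kcost m P C"
        by metis
      have "\<not> inj_on f P"
        using card_inj_on_le[of f P C] f(1) C assms(4) by auto
      then obtain x y where xy: "x \<in> P" "y \<in> P" "x \<noteq> y" "f x = f y" by (auto simp: inj_on_def)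
      have "edist m x y \<le> edist m x (f x) + edist m y (f y)"
        using edist_triangle[of m x y "f x"] edist_commute[of m "f x" y] xy by simp
      also have "\<dots> \<le> 2 * kcost m P C" using f(2)[OF xy(1)] f(2)[OF xy(2)] by linarith
      also have "\<dots> \<le> 1 / 2 ^ n" using small by simp
      finally have "edist m x y = 0" by (rule n[OF xy(1,2)])
      then show False using xy edist_eq_0_iff[of x m y] assms(2) by auto
    qed
  qed
  moreover have "(0::real) < 1 / 2 ^ Suc n" by simp
  ultimately show ?thesis by linarith
qed

text \<open>A slack over the infimum replaces an optimal solution, whose existence would take a
  compactness argument.\<close>

lemma ex_near_optimal_centers:
  assumes "finite P" "P \<subseteq> vecs m" "1 \<le> k" "k < card P" "0 < \<delta>"
  obtains C R where "C \<subseteq> vecs m" "finite C" "card C = k" "opt_vanilla m k P \<le> R"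
    "R \<le> (1 + \<delta>) * opt_vanilla m k P" "\<And>x. x \<in> P \<Longrightarrow> \<exists>c\<in>C. edist m x c \<le> R"
proof -
  have ne: "P \<noteq> {}" using assms by auto
  have m: "m \<ge> 1" using card_le_1_if_dim_0[of P] assms by (cases m) auto
  have "opt_vanilla m k P < (1 + \<delta>) * opt_vanilla m k P"
    using opt_vanilla_pos[OF assms(1-4)] assms(5) by simp
  moreover define S where "S = {C. C \<subseteq> vecs m \<and> finite C \<and> card C = k}"
  ultimately have lt: "Inf (kcost m P ` S) < (1 + \<delta>) * opt_vanilla m k P"
    by (simp add: opt_vanilla_def)
  have "kcost m P ` S \<noteq> {}" using ex_centers[of m k] m by (simp add: S_def)
  from cInf_lessD[OF this lt] obtain C where "C \<in> S" "kcost m P C < (1 + \<delta>) * opt_vanilla m k P"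
    by auto
  then have C: "C \<subseteq> vecs m" "finite C" "card C = k" "kcost m P C < (1 + \<delta>) * opt_vanilla m k P"
    by (simp_all add: S_def)
  have "C \<noteq> {}" using C assms(3) by auto
  show ?thesis
  proof (rule that[OF C(1-3)])
    show "opt_vanilla m k P \<le> kcost m P C"
      by (rule opt_vanilla_le_kcost) (use assms ne C in auto)
    show "kcost m P C \<le> (1 + \<delta>) * opt_vanilla m k P" using C by simp
    show "\<exists>c\<in>C. edist m x c \<le> kcost m P C" if "x \<in> P" for x
      using kcost_le_iff[OF assms(1) ne C(2) \<open>C \<noteq> {}\<close>, of m "kcost m P C"] that by simp
  qed
qed

section \<open>From bounds on distances to k-center values\<close>

text \<open>The deterministic half of the proof. Multiplicative control is available only at net
  points, so every estimate passes through them; a detour to the net costs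
  \<open>\<delta> * R\<close> in the source and \<open>40 * (\<delta> * R)\<close> in the
  target.\<close>

lemma embedding_preserves_kcenter:
  fixes g :: "(nat \<Rightarrow> real) \<Rightarrow> (nat \<Rightarrow> real)"
  assumes P: "finite P" "P \<subseteq> vecs d" "1 \<le> k" "k < card P" and t: "t \<ge> 1"
    and \<delta>: "0 < \<delta>" "\<delta> < 1/400" and g: "\<And>x. g x \<in> vecs t"
    and C0: "finite C0" "card C0 = k"
      "opt_vanilla d k P \<le> R" "R \<le> (1 + \<delta>) * opt_vanilla d k P"
      "\<And>x. x \<in> P \<Longrightarrow> \<exists>c\<in>C0. edist d x c \<le> R"
    and N: "N \<subseteq> P" "\<And>x. x \<in> P \<Longrightarrow> \<exists>y\<in>N. edist d y x \<le> \<delta> * R"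
    and lower: "\<And>u w. u \<in> N \<Longrightarrow> w \<in> N \<Longrightarrow> (1 - \<delta>) * edist d u w \<le> edist t (g u) (g w)"
    and upper: "\<And>u w. u \<in> N \<Longrightarrow> w \<in> C0 \<Longrightarrow> edist t (g u) (g w) \<le> (1 + \<delta>) * edist d u w"
    and local_exp: "\<And>y x. y \<in> N \<Longrightarrow> x \<in> P \<Longrightarrow> edist d y x \<le> \<delta> * R \<Longrightarrow> edist t (g y) (g x) \<le> 40 * (\<delta> * R)"
  shows "opt_vanilla d k P / (1 + 200 * \<delta>) \<le> opt_vanilla t k (g ` P)" (is ?lo)
    and "opt_vanilla t k (g ` P) \<le> (1 + 200 * \<delta>) * opt_vanilla d k P" (is ?up)
    and "\<And>\<alpha> C. \<alpha> \<ge> 1 \<Longrightarrow> C \<subseteq> P \<Longrightarrow> card C = k \<Longrightarrow> approx_sol t k \<alpha> (g ` P) (g ` C) \<Longrightarrow>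
      approx_sol d k (\<alpha> * (1 + 200 * \<delta>)) P C"
proof -
  define o' where "o' = opt_vanilla d k P"
  \<comment> \<open>Additive errors are counted in units of \<open>q\<close>, and the final factor
    allows 200 of them. The net radius \<open>s\<close> is at most \<open>1.01 * q\<close>.\<close>
  define q where "q = \<delta> * o'"
  define s where "s = \<delta> * R"
  have ne: "P \<noteq> {}" using P by auto
  have d1: "d \<ge> 1" using card_le_1_if_dim_0[of P] P by (cases d) auto
  have pos: "o' > 0" unfolding o'_def by (rule opt_vanilla_pos[OF P])
  have q0: "q > 0" using pos \<delta> by (simp add: q_def)
  have R: "o' \<le> R" "R \<le> o' + q" using C0(3,4) by (auto simp: o'_def q_def algebra_simps)
  have "\<delta> * q \<le> q / 400" using mult_right_mono[of \<delta> "1/400" q] \<delta> q0 by simp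
  moreover have "s \<le> q + \<delta> * q"
    using mult_left_mono[OF R(2), of \<delta>] \<delta> by (simp add: s_def q_def distrib_left)
  ultimately have \<delta>q: "\<delta> * q \<le> q / 400" "s \<le> 101/100 * q" using q0 by linarith+
  have s0: "s \<ge> 0" using R pos \<delta> by (simp add: s_def)
  have \<delta>s: "\<delta> * s \<le> s / 400" "\<delta> * s \<ge> 0" using mult_right_mono[of \<delta> "1/400" s] \<delta> s0 by auto
  have target: "(1 + 200 * \<delta>) * o' = o' + 200 * q" by (simp add: q_def algebra_simps)
  have gP: "finite (g ` P)" "g ` P \<noteq> {}" using P ne by auto
  have "C0 \<noteq> {}" using C0(2) P(3) by auto
  \<comment> \<open>The way from \<open>g x\<close> to its net point costs \<open>40 * s\<close>,
    and from there to the image of a centre at most \<open>R + 3 * s\<close>. The constant 45 is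
    kept because part (2) spends the rest of the 200 elsewhere.\<close>
  have opt_upper: "opt_vanilla t k (g ` P) \<le> o' + 45 * q"
  proof (rule opt_vanilla_le[OF gP, of _ "g ` C0"])
    fix x' assume "x' \<in> g ` P"
    then obtain x where x: "x \<in> P" "x' = g x" by auto
    obtain y where y: "y \<in> N" "edist d y x \<le> s" using N(2)[OF x(1)] by (auto simp: s_def)
    obtain c where c: "c \<in> C0" "edist d x c \<le> R" using C0(5)[OF x(1)] by auto
    have "edist d y c \<le> R + s" using edist_triangle[of d y c x] y c by linarith
    then have "(1 + \<delta>) * edist d y c \<le> (1 + \<delta>) * (R + s)" using \<delta> by (intro mult_left_mono) auto
    also have "\<dots> = R + 2 * s + \<delta> * s" by (simp add: s_def algebra_simps)
    finally have "edist t (g y) (g c) \<le> R + 3 * s" using upper[OF y(1) c(1)] \<delta>s s0 by linarith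
    moreover have "edist t (g x) (g y) \<le> 40 * s"
      using local_exp[OF y(1) x(1)] y(2) edist_commute[of t "g x" "g y"] by (simp add: s_def)
    ultimately have "edist t (g x) (g c) \<le> o' + 45 * q"
      using edist_triangle[of t "g x" "g c" "g y"] R \<delta>q q0 by linarith
    then show "\<exists>c\<in>g ` C0. edist t x' c \<le> o' + 45 * q" using c x by auto
  qed (use t g C0 \<open>C0 \<noteq> {}\<close> card_image_le[OF C0(1), of g] in auto)
  then show ?up using target q0 by (simp add: o'_def)
  show ?lo
    unfolding opt_vanilla_def[of t]
  proof (rule cINF_greatest[OF ex_centers])
    show "t \<ge> 1 \<or> k = 1" using t by simp
    fix C' assume "C' \<in> {C. C \<subseteq> vecs t \<and> finite C \<and> card C = k}"
    then have C': "finite C'" "card C' = k" "C' \<noteq> {}" using P(3) by auto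
    define r where "r = kcost t (g ` P) C'"
    have r0: "r \<ge> 0" unfolding r_def by (rule kcost_nonneg[OF gP C'(1,3)])
    have near: "\<exists>c\<in>C'. edist t (g x) c \<le> r" if "x \<in> P" for x
      using kcost_le_iff[OF gP C'(1,3), of t r] that by (simp add: r_def)
    \<comment> \<open>On the net, the inverse of \<open>g\<close> has Lipschitz constant
      \<open>1 / (1 - \<delta>)\<close>, so the ball about a target centre \<open>c'\<close> yields
      an enclosing ball in the source. An empty cluster gets the origin.\<close>
    have "\<exists>c\<in>vecs d. \<forall>y\<in>N. edist t (g y) c' \<le> r \<longrightarrow> edist d y c \<le> 1 / (1 - \<delta>) * r" for c'
    proof (cases "{y\<in>N. edist t (g y) c' \<le> r} = {}")
      case True
      then show ?thesis by (intro bexI[of _ "\<lambda>_. 0"]) (auto simp: vecs_def)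
    next
      case False
      let ?I = "{y\<in>N. edist t (g y) c' \<le> r}"
      show ?thesis
      proof (rule enclosing_ball_lipschitz[of ?I "\<lambda>y. y" d "1 / (1 - \<delta>)" t g c' r])
        show "finite ?I" using finite_subset[OF N(1) P(1)] by simp
        show "?I \<noteq> {}" by (rule False)
        show "u \<in> vecs d" if "u \<in> ?I" for u using that N(1) P(2) by auto
        show "edist d u w \<le> 1 / (1 - \<delta>) * edist t (g u) (g w)" if "u \<in> ?I" "w \<in> ?I" for u w
          using lower[of u w] that \<delta> by (simp add: field_simps)
        show "edist t (g u) c' \<le> r" if "u \<in> ?I" for u using that by simp
        show "0 \<le> 1 / (1 - \<delta>)" "0 \<le> r" using \<delta> r0 by simp_all
        fix c assume "c \<in> vecs d" "\<And>u. u \<in> ?I \<Longrightarrow> edist d u c \<le> 1 / (1 - \<delta>) * r"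
        then show ?thesis by (intro bexI[of _ c]) auto
      qed
    qed
    then obtain h where h: "\<And>c'. h c' \<in> vecs d"
      "\<And>c' y. y \<in> N \<Longrightarrow> edist t (g y) c' \<le> r \<Longrightarrow> edist d y (h c') \<le> 1 / (1 - \<delta>) * r"
      by metis
    have "o' \<le> s + 1 / (1 - \<delta>) * r"
      unfolding o'_def
    proof (rule opt_vanilla_le[OF P(1) ne, of _ "h ` C'"])
      fix x assume x: "x \<in> P"
      obtain y where y: "y \<in> N" "edist d y x \<le> s" using N(2)[OF x] by (auto simp: s_def)
      obtain c where c: "c \<in> C'" "edist t (g y) c \<le> r" using near y(1) N(1) by blast
      have "edist d x (h c) \<le> s + 1 / (1 - \<delta>) * r"
        using edist_triangle[of d x "h c" y] edist_commute[of d x y] y(2) h(2)[OF y(1) c(2)] by linarith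
      then show "\<exists>c\<in>h ` C'. edist d x c \<le> s + 1 / (1 - \<delta>) * r" using c by auto
    qed (use d1 h C' card_image_le[OF C'(1), of h] in auto)
    then have "(1 - \<delta>) * (o' - s) \<le> r" using \<delta> by (simp add: field_simps)
    moreover have "(1 - \<delta>) * (o' - s) = o' - s - q + \<delta> * s" by (simp add: q_def algebra_simps)
    ultimately have "o' - 3 * q \<le> r" using \<delta>s \<delta>q q0 by linarith
    \<comment> \<open>The factor gains \<open>200 * q\<close>, which outweighs the loss of
      \<open>3 * q\<close> and the second-order term
      \<open>600 * (\<delta> * q) <= 1.5 * q\<close>.\<close>
    then have "(1 + 200 * \<delta>) * (o' - 3 * q) \<le> (1 + 200 * \<delta>) * r" using \<delta> by (intro mult_left_mono) auto
    moreover have "(1 + 200 * \<delta>) * (o' - 3 * q) = o' + 197 * q - 600 * (\<delta> * q)"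
      by (simp add: q_def algebra_simps)
    ultimately have "o' \<le> (1 + 200 * \<delta>) * r" using \<delta>q q0 by linarith
    then show "opt_vanilla d k P / (1 + 200 * \<delta>) \<le> kcost t (g ` P) C'"
      using \<delta> by (simp add: o'_def r_def field_simps)
  qed
  fix \<alpha> :: real and C assume \<alpha>: "\<alpha> \<ge> 1" and C: "C \<subseteq> P" "card C = k"
    and sol: "approx_sol t k \<alpha> (g ` P) (g ` C)"
  have C': "finite C" "C \<noteq> {}" using C P finite_subset by auto
  have "kcost t (g ` P) (g ` C) \<le> \<alpha> * opt_vanilla t k (g ` P)"
    using sol by (simp add: approx_sol_def)
  also have "\<dots> \<le> \<alpha> * (o' + 45 * q)" using opt_upper \<alpha> by (intro mult_left_mono) auto
  finally have near: "\<forall>x\<in>g ` P. \<exists>c\<in>g ` C. edist t x c \<le> \<alpha> * (o' + 45 * q)"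
    using gP C' by (subst (asm) kcost_le_iff) auto
  \<comment> \<open>This absorbs additive errors of order \<open>q\<close> into multiples of
    \<open>\<alpha> * q\<close>.\<close>
  have \<alpha>q: "q \<le> \<alpha> * q" using \<alpha> q0 by simp
  have "\<forall>x\<in>P. \<exists>c\<in>C. edist d x c \<le> \<alpha> * (1 + 200 * \<delta>) * o'"
  proof
    fix x assume x: "x \<in> P"
    obtain c where c: "c \<in> C" "edist t (g x) (g c) \<le> \<alpha> * (o' + 45 * q)" using near x by blast
    then have "c \<in> P" using C by auto
    obtain y where y: "y \<in> N" "edist d y x \<le> s" using N(2)[OF x] by (auto simp: s_def)
    obtain z where z: "z \<in> N" "edist d z c \<le> s" using N(2)[OF \<open>c \<in> P\<close>] by (auto simp: s_def)
    have "edist t (g y) (g x) \<le> 40 * s" "edist t (g z) (g c) \<le> 40 * s"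
      using local_exp[OF y(1) x] local_exp[OF z(1) \<open>c \<in> P\<close>] y(2) z(2) by (auto simp: s_def)
    then have yz: "edist t (g y) (g z) \<le> \<alpha> * (o' + 45 * q) + 80 * s"
      using edist_triangle[of t "g y" "g z" "g x"] edist_triangle[of t "g x" "g z" "g c"]
        edist_commute[of t "g c" "g z"] c(2) by linarith
    have "(1 - \<delta>) * edist d y z \<le> \<alpha> * o' + 126 * (\<alpha> * q)"
    proof -
      have "\<alpha> * (o' + 45 * q) = \<alpha> * o' + 45 * (\<alpha> * q)" by (simp add: distrib_left)
      then show ?thesis
        using lower[OF y(1) z(1)] \<delta>q \<alpha>q q0 yz by linarith
    qed
    also have "\<dots> \<le> (1 - \<delta>) * (\<alpha> * o' + 130 * (\<alpha> * q))"
    proof -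
      have "(1 - \<delta>) * (\<alpha> * o' + 130 * (\<alpha> * q)) = \<alpha> * o' + 129 * (\<alpha> * q) - 130 * (\<alpha> * (\<delta> * q))"
        by (simp add: q_def algebra_simps)
      moreover have "\<alpha> * (\<delta> * q) \<le> \<alpha> * (q / 400)" using \<delta>q \<alpha> by (intro mult_left_mono) auto
      ultimately show ?thesis using \<alpha>q q0 by simp
    qed
    finally have "edist d y z \<le> \<alpha> * o' + 130 * (\<alpha> * q)"
      using \<delta> by simp
    then have "edist d x c \<le> \<alpha> * o' + 200 * (\<alpha> * q)"
      using edist_triangle[of d x c y] edist_triangle[of d y c z] edist_commute[of d x y] y(2) z(2) \<delta>q \<alpha>q q0
      by linarith
    then show "\<exists>c\<in>C. edist d x c \<le> \<alpha> * (1 + 200 * \<delta>) * o'"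
      using c(1) by (auto simp: q_def algebra_simps intro!: bexI[of _ c])
  qed
  then show "approx_sol d k (\<alpha> * (1 + 200 * \<delta>)) P C"
    using C C' ne P(1) by (simp add: approx_sol_def kcost_le_iff o'_def)
qed

text \<open>The pairs fail with probability at most \<open>2 * M^2\<close> times
  \<open>exp (- t * \<delta>^2 / 16)\<close>, the balls with at most \<open>M^2\<close> times the
  same exponential. The condition on \<open>t\<close> makes it at most \<open>1 / (9 * M^2)\<close>,
  so the sum is at most 3/9.\<close>

lemma except_prob_net:
  assumes "t \<ge> 1" "0 < \<delta>" "\<delta> < 1" and dbl: "doubling d P L" and L: "L \<ge> 0" "L * 2 * exp (- real t) \<le> 1"
    and "finite P" "N \<subseteq> P" "finite C0" "r > 0"
    and M: "real (card N) + real (card C0) \<le> M" "M \<ge> 1"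
    and t: "real t * \<delta>\<^sup>2 / 16 \<ge> ln 9 + 2 * ln M"
  shows "except_prob (gauss_mat t d) (1/3) (\<lambda>G.
     (\<forall>(u,w)\<in>(N \<union> C0) \<times> (N \<union> C0). (1 - \<delta>) * edist d u w \<le> edist t (mat_app t d G u) (mat_app t d G w) \<and>
         edist t (mat_app t d G u) (mat_app t d G w) \<le> (1 + \<delta>) * edist d u w) \<and>
     (\<forall>y\<in>N. \<forall>x\<in>cballP d P y r. edist t (mat_app t d G y) (mat_app t d G x) \<le> 40 * r))"
proof -
  interpret prob_space "gauss_mat t d" by (rule prob_space_gauss_mat)
  let ?F = "N \<union> C0" and ?e = "exp (- real t * \<delta>\<^sup>2 / 16)"
  have fin: "finite N" "finite ?F" using assms finite_subset by auto
  have pairs: "except_prob (gauss_mat t d) (real (card (?F \<times> ?F)) * (2 * ?e))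
    (\<lambda>G. \<forall>p\<in>?F \<times> ?F. case p of (u,w) \<Rightarrow> (1 - \<delta>) * edist d u w \<le> edist t (mat_app t d G u) (mat_app t d G w) \<and>
         edist t (mat_app t d G u) (mat_app t d G w) \<le> (1 + \<delta>) * edist d u w)"
    using fin except_prob_distortion[OF assms(1-3)] by (intro except_prob_ball) auto
  obtain n where "\<And>u w. u \<in> P \<Longrightarrow> w \<in> P \<Longrightarrow> edist d u w \<le> r / 2 ^ n \<Longrightarrow> edist d u w = 0"
    using finite_separated[OF \<open>finite P\<close> \<open>r > 0\<close>] by blast
  then have balls: "except_prob (gauss_mat t d) (real (card N) * exp (- real t * 40))
     (\<lambda>G. \<forall>y\<in>N. \<forall>x\<in>cballP d P y r. edist t (mat_app t d G y) (mat_app t d G x) \<le> 40 * r)"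
    using \<open>N \<subseteq> P\<close> \<open>r > 0\<close> fin
    by (intro except_prob_ball except_prob_ball_expansion[OF assms(1) dbl L]) auto
  show ?thesis
  proof (rule except_prob_mono[OF except_prob_conj[OF pairs balls]])
    have cF: "real (card ?F) \<le> M" using card_Un_le[of N C0] M(1) by linarith
    have "real (card (?F \<times> ?F)) \<le> M * M"
      unfolding card_cartesian_product of_nat_mult using cF M(2) by (intro mult_mono) auto
    moreover have "real (card N) \<le> M * M"
    proof -
      have "real (card N) \<le> M * 1" using M by simp
      also have "\<dots> \<le> M * M" using M(2) by (intro mult_left_mono) auto
      finally show ?thesis .
    qed
    moreover have "exp (- real t * 40) \<le> ?e"
    proof -
      have "\<delta>\<^sup>2 / 16 \<le> 40" using power_le_one[of \<delta> 2] assms(2,3) by simp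
      then have "real t * (\<delta>\<^sup>2 / 16) \<le> real t * 40" by (intro mult_left_mono) auto
      then show ?thesis by simp
    qed
    ultimately have "real (card (?F \<times> ?F)) * (2 * ?e) + real (card N) * exp (- real t * 40)
       \<le> M * M * (2 * ?e) + M * M * ?e"
      using M(2) by (intro add_mono mult_mono) auto
    also have "\<dots> = 3 * (M * M * ?e)" by simp
    also have "M * M * ?e \<le> 1 / 9"
    proof -
      have "?e \<le> exp (- (ln 9 + 2 * ln M))" using t by simp
      also have "\<dots> = 1 / (9 * (M * M))"
        unfolding exp_minus mult_2 exp_add using M(2) by (simp add: inverse_eq_divide)
      finally show ?thesis using M(2) by (simp add: field_simps)
    qed
    finally show "real (card (?F \<times> ?F)) * (2 * ?e) + real (card N) * exp (- real t * 40) \<le> 1/3" by simp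
  qed auto
qed

text \<open>With \<open>x = \<delta>\<close>, this many halvings take the radius
  \<open>2 * R\<close> to at most \<open>\<delta> * R\<close>. Rounding up costs one factor 2, which
  turns \<open>2 / x\<close> into \<open>4 / x\<close>.\<close>

lemma ex_halvings:
  assumes "0 < (x::real)" "x \<le> 1"
  obtains n where "2 / 2 ^ n \<le> x" "real n * ln 2 \<le> ln (4 / x)"
proof
  define n where "n = nat \<lceil>log 2 (2 / x)\<rceil>"
  have l: "log 2 (2 / x) \<ge> 0" using assms by simp
  have "log 2 (2 / x) \<le> real n" by (simp add: n_def real_nat_ceiling_ge)
  then have "2 / x \<le> 2 powr real n" using assms by (simp add: log_le_iff)
  then show "2 / 2 ^ n \<le> x" using assms by (simp add: powr_realpow field_simps)
  have "real n \<le> log 2 (2 / x) + 1" using l by (simp add: n_def)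
  then have "real n * ln 2 \<le> (log 2 (2 / x) + 1) * ln 2" by (intro mult_right_mono) auto
  also have "\<dots> = ln (4 / x)"
  proof -
    have "ln (4::real) = 2 * ln 2" using ln_realpow[of 2 2] by simp
    then show ?thesis using assms by (simp add: log_def ln_div distrib_right)
  qed
  finally show "real n * ln 2 \<le> ln (4 / x)" .
qed

lemma ex_edist_le_0: "x \<in> X \<Longrightarrow> \<exists>c\<in>X. edist m x c \<le> 0"
  by (rule bexI[of _ x]) auto

subsection \<open>Choice of the target dimension\<close>

theorem theorem5p1:
  "\<exists>c::real. c > 0 \<and>
    (\<forall>(d::nat) (P::(nat \<Rightarrow> real) set) (k::nat) (\<epsilon>::real) (t::nat).
      finite P \<longrightarrow> P \<subseteq> vecs d \<longrightarrow> 1 \<le> k \<longrightarrow> k \<le> card P \<longrightarrow> 0 < \<epsilon> \<longrightarrow> \<epsilon> < 1/2 \<longrightarrow>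
      t = nat \<lceil>c * (ln (real k) / \<epsilon>^2 + ln (1/\<epsilon>) / \<epsilon>^2 * ddim d P)\<rceil> \<longrightarrow>
      (\<exists>A \<in> sets (gauss_mat t d). measure (gauss_mat t d) A \<ge> 2/3 \<and>
        (\<forall>G\<in>A.
          opt_vanilla d k P / (1 + \<epsilon>) \<le> opt_vanilla t k (mat_app t d G ` P) \<and>
          opt_vanilla t k (mat_app t d G ` P) \<le> (1 + \<epsilon>) * opt_vanilla d k P \<and>
          (\<forall>\<alpha>\<ge>1. \<forall>C. C \<subseteq> P \<longrightarrow> card C = k \<longrightarrow>
             approx_sol t k \<alpha> (mat_app t d G ` P) (mat_app t d G ` C) \<longrightarrow>
             approx_sol d k (\<alpha> * (1 + \<epsilon>)) P C))))"
(* 32000000 = 50 * 16 * 200^2: delta = eps / 200, the distortion tail is exp (- t delta^2 / 16),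
   and the union bound costs at most 50 (ln k + ln (1/eps) ddim). *)
proof (intro exI[of _ "32000000::real"] conjI allI impI)
  fix d :: nat and P :: "(nat \<Rightarrow> real) set" and k :: nat and \<epsilon> :: real and t :: nat
  assume P: "finite P" "P \<subseteq> vecs d" and k: "1 \<le> k" "k \<le> card P" and \<epsilon>: "0 < \<epsilon>" "\<epsilon> < 1/2"
    and t_def: "t = nat \<lceil>32000000 * (ln (real k) / \<epsilon>^2 + ln (1/\<epsilon>) / \<epsilon>^2 * ddim d P)\<rceil>"
  interpret prob_space "gauss_mat t d" by (rule prob_space_gauss_mat)
  define good where "good G \<longleftrightarrow>
          opt_vanilla d k P / (1 + \<epsilon>) \<le> opt_vanilla t k (mat_app t d G ` P) \<and>
          opt_vanilla t k (mat_app t d G ` P) \<le> (1 + \<epsilon>) * opt_vanilla d k P \<and>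
          (\<forall>\<alpha>\<ge>1. \<forall>C. C \<subseteq> P \<longrightarrow> card C = k \<longrightarrow>
             approx_sol t k \<alpha> (mat_app t d G ` P) (mat_app t d G ` C) \<longrightarrow>
             approx_sol d k (\<alpha> * (1 + \<epsilon>)) P C)" for G
  have ne: "P \<noteq> {}" using k by auto
  define D where "D = ddim d P"
  define \<kappa> where "\<kappa> = ln (1 / \<epsilon>)"
  have "ln 2 \<le> \<kappa>" unfolding \<kappa>_def using \<epsilon> by (subst ln_le_cancel_iff) (auto simp: field_simps)
  have D0: "D \<ge> 0" unfolding D_def by (rule ddim_nonneg[OF P(1) ne])
  have ln2: "(ln 2 :: real) > 0" by simp
  have lnk: "ln (real k) \<ge> 0" using k by simp
  have "32000000 * (ln (real k) / \<epsilon>^2 + \<kappa> / \<epsilon>^2 * D) \<le> real t"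
    unfolding t_def \<kappa>_def D_def by (rule real_nat_ceiling_ge)
  then have t: "32000000 * (ln (real k) + \<kappa> * D) \<le> real t * \<epsilon>\<^sup>2"
    using \<epsilon> by (simp add: field_simps)
  have t_pos: "t \<ge> 1" if "0 < ln (real k) + \<kappa> * D"
    using t that by (cases "t = 0") auto
  have "except_prob (gauss_mat t d) (1/3) good"
  \<comment> \<open>If every point can be its own centre, both optima vanish and the claims hold for
    every \<open>G\<close>. The net argument, which requires a positive optimum, treats
    \<open>k < card P\<close>.\<close>
  proof (cases "k = card P")
    case True
    have "k = 1" if "d = 0" using card_le_1_if_dim_0[of P] P k that by auto
    then have "0 \<le> opt_vanilla d k P" using P k ne by (intro opt_vanilla_nonneg) auto
    moreover have "opt_vanilla d k P \<le> 0"
      by (rule opt_vanilla_le[OF _ _ _ _ _ _ _ ex_edist_le_0]) (use P k ne True in auto)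
    ultimately have opt: "opt_vanilla d k P = 0" by simp
    have "good G" for G
    proof -
      let ?g = "mat_app t d G"
      have card: "card (?g ` P) \<le> k" "card (?g ` P) \<ge> 1"
        using card_image_le[OF P(1)] True P ne by (auto simp: Suc_le_eq card_gt_0_iff)
      \<comment> \<open>The target dimension can be 0, but only for \<open>k = 1\<close>, where the
        single vector of dimension 0 serves as centre.\<close>
      have t1: "t \<ge> 1 \<or> k = 1"
      proof (cases "k = 1")
        case False
        then have "ln (real k) > 0" using k by simp
        then show ?thesis using t_pos D0 \<open>ln 2 \<le> \<kappa>\<close> ln2 by (simp add: add_pos_nonneg)
      qed simp
      have "0 \<le> opt_vanilla t k (?g ` P)" using P k ne t1 by (intro opt_vanilla_nonneg) auto
      moreover have "opt_vanilla t k (?g ` P) \<le> 0"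
      proof (rule opt_vanilla_le[OF _ _ _ _ _ _ _ ex_edist_le_0])
        show "t \<ge> 1 \<or> card (?g ` P) = k" using t1 card by auto
      qed (use P ne card mat_app_in_vecs in auto)
      moreover have "approx_sol d k \<beta> P C" if "C \<subseteq> P" "card C = k" for \<beta> C
      proof -
        have "C = P" using that True P(1) by (simp add: card_subset_eq)
        moreover have "kcost d P P \<le> 0"
          unfolding kcost_le_iff[OF P(1) ne P(1) ne] by (metis edist_self order_refl)
        ultimately show ?thesis using that by (simp add: approx_sol_def opt)
      qed
      ultimately show ?thesis by (simp add: good_def opt)
    qed
    then show ?thesis by (intro except_prob_always) auto
  next
    case False
    then have k': "k < card P" using k by simp
    \<comment> \<open>Dimension at least 1 gives \<open>ln 2 <= \<kappa> * D\<close>, by which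
      additive constants are absorbed.\<close>
    have D1: "D \<ge> 1" unfolding D_def using P k k' by (intro ddim_ge_1) auto
    have lD: "ln 2 \<le> \<kappa> * D" using mult_mono[OF \<open>ln 2 \<le> \<kappa>\<close> D1] ln2 \<open>ln 2 \<le> \<kappa>\<close> by simp
    then have t1: "t \<ge> 1" using t_pos lnk ln2 by linarith
    define \<delta> where "\<delta> = \<epsilon> / 200"
    have \<delta>: "0 < \<delta>" "\<delta> < 1/400" "1 + 200 * \<delta> = 1 + \<epsilon>" using \<epsilon> by (auto simp: \<delta>_def)
    obtain C0 R where C0: "C0 \<subseteq> vecs d" "finite C0" "card C0 = k" "opt_vanilla d k P \<le> R"
      "R \<le> (1 + \<delta>) * opt_vanilla d k P" "\<And>x. x \<in> P \<Longrightarrow> \<exists>c\<in>C0. edist d x c \<le> R"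
      using ex_near_optimal_centers[OF P k(1) k' \<delta>(1)] by blast
    have R: "R > 0" using opt_vanilla_pos[OF P k(1) k'] C0(4) by linarith
    define L where "L = (2::real) powr (2 * D)"
    have dbl: "doubling d P L"
      unfolding L_def D_def using D1 by (intro doubling_2_ddim P ne) (simp add: D_def)
    have L: "L \<ge> 1" "ln L = 2 * D * ln 2" using D0 by (auto simp: L_def ln_powr ge_one_powr_ge_zero)
    have L0: "L \<ge> 0" using L(1) by simp
    obtain n where n: "2 / 2 ^ n \<le> \<delta>" "real n * ln 2 \<le> ln (4 / \<delta>)"
      using ex_halvings[of \<delta>] \<delta> by auto
    obtain N where N: "N \<subseteq> P" "finite N" "real (card N) \<le> real (card C0) * L ^ n"
       "\<And>x. x \<in> P \<Longrightarrow> \<exists>y\<in>N. edist d y x \<le> 2 * R / 2 ^ n"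
      by (rule ex_net_of_clusters[OF dbl L0 C0(2) R C0(6), of n]) (assumption, rule that)
    have net: "\<exists>y\<in>N. edist d y x \<le> \<delta> * R" if "x \<in> P" for x
    proof -
      have "2 * R / 2 ^ n \<le> \<delta> * R" using mult_right_mono[OF n(1), of R] R by simp
      then show ?thesis using N(4)[OF that] by force
    qed
    define M where "M = 2 * real k * L ^ n"
    have Ln: "L ^ n \<ge> 1" using L(1) by simp
    have M: "real (card N) + real (card C0) \<le> M" "M \<ge> 1"
    proof -
      have "real k * 1 \<le> real k * L ^ n" using Ln by (intro mult_left_mono) auto
      moreover have "M = 2 * (real k * L ^ n)" by (simp add: M_def)
      moreover have "real (card N) \<le> real k * L ^ n" using N(3) by (simp add: C0(3))
      ultimately show "real (card N) + real (card C0) \<le> M" "M \<ge> 1"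
        using C0(3) k(1) by linarith+
    qed
    \<comment> \<open>Here \<open>4 / \<delta> = 800 / \<epsilon>\<close>, and ten factors
      \<open>1 / \<epsilon> > 2\<close> exceed 800.\<close>
    have "ln (4 / \<delta>) \<le> 11 * \<kappa>"
    proof -
      have "(800::real) \<le> 2 ^ 10" by simp
      also have "\<dots> \<le> (1 / \<epsilon>) ^ 10" using \<epsilon> by (intro power_mono) (auto simp: field_simps)
      finally have "4 / \<delta> \<le> (1 / \<epsilon>) ^ 10 * (1 / \<epsilon>)"
        using mult_right_mono[of 800 "(1 / \<epsilon>) ^ 10" "1 / \<epsilon>"] \<epsilon> by (simp add: \<delta>_def)
      also have "\<dots> = (1 / \<epsilon>) ^ 11" by (subst power_Suc2[symmetric]) simp
      finally have "ln (4 / \<delta>) \<le> ln ((1 / \<epsilon>) ^ 11)" using \<delta> \<epsilon> by (subst ln_le_cancel_iff) auto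
      also have "\<dots> = 11 * \<kappa>" unfolding \<kappa>_def using \<epsilon> by (subst ln_realpow) auto
      finally show ?thesis .
    qed
    then have nl: "2 * D * (real n * ln 2) \<le> 2 * D * (11 * \<kappa>)"
      using n(2) D0 by (intro mult_left_mono) auto
    have "ln M = ln 2 + ln (real k) + real n * ln L"
      using k(1) L(1) by (simp add: M_def ln_mult ln_realpow)
    also have "real n * ln L = 2 * D * (real n * ln 2)" by (simp add: L(2))
    finally have lnM: "ln M \<le> ln 2 + ln (real k) + 22 * (\<kappa> * D)" using nl by (simp add: algebra_simps)
    have "ln (9::real) \<le> ln 16" by simp
    also have "ln (16::real) = 4 * ln 2" using ln_realpow[of 2 4] by simp
    finally have ln9: "ln (9::real) \<le> 4 * ln 2" .
    have t_eq: "real t * \<delta>\<^sup>2 / 16 = real t * \<epsilon>\<^sup>2 / 640000" by (simp add: \<delta>_def power_divide)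
    \<comment> \<open>The right side is at most
      \<open>6 * ln 2 + 2 * ln k + 44 * (\<kappa> * D)\<close>, and
      \<open>6 * ln 2 <= 6 * (\<kappa> * D)\<close> brings the last coefficient to 50.\<close>
    have t\<delta>: "real t * \<delta>\<^sup>2 / 16 \<ge> ln 9 + 2 * ln M"
    proof -
      have "50 * ln (real k) + 50 * (\<kappa> * D) \<le> real t * \<epsilon>\<^sup>2 / 640000" using t by simp
      moreover have "ln 9 + 2 * ln M \<le> 50 * ln (real k) + 50 * (\<kappa> * D)"
        using lnM ln9 lD lnk ln2 by linarith
      ultimately show ?thesis
        unfolding t_eq by linarith
    qed
    \<comment> \<open>The chaining requires \<open>2 * L <= exp t\<close>. Indeed
      \<open>ln (2 * L) = (1 + 2 * D) * ln 2\<close> is at most \<open>3 * (\<kappa> * D)\<close>,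
      far below \<open>t\<close>.\<close>
    have "\<epsilon>\<^sup>2 \<le> 1" using \<epsilon> by (simp add: power_le_one)
    then have "real t * \<epsilon>\<^sup>2 \<le> real t" by (simp add: mult_left_le)
    moreover have "D * ln 2 \<le> \<kappa> * D" using mult_right_mono[OF \<open>ln 2 \<le> \<kappa>\<close> D0] by (simp add: mult.commute)
    ultimately have "ln (L * 2) \<le> real t" using L t lnk lD ln2 by (simp add: ln_mult)
    then have "exp (ln (L * 2)) \<le> exp (real t)" by (simp only: exp_le_cancel_iff)
    then have "L * 2 \<le> exp (real t)" using L(1) by (subst (asm) exp_ln) auto
    then have Lt: "L * 2 * exp (- real t) \<le> 1" by (simp add: exp_minus field_simps)
    show ?thesis
    proof (rule except_prob_mono[OF except_prob_net[OF t1 \<delta>(1) _ dbl _ Lt P(1) N(1) C0(2) _ M t\<delta>]])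
      show "\<delta> < 1" "0 \<le> L" "0 < \<delta> * R" using \<delta> L(1) R by auto
      fix G
      let ?g = "mat_app t d G"
      assume G: "(\<forall>(u,w)\<in>(N \<union> C0) \<times> (N \<union> C0). (1 - \<delta>) * edist d u w \<le> edist t (?g u) (?g w) \<and>
         edist t (?g u) (?g w) \<le> (1 + \<delta>) * edist d u w) \<and>
       (\<forall>y\<in>N. \<forall>x\<in>cballP d P y (\<delta> * R). edist t (?g y) (?g x) \<le> 40 * (\<delta> * R))"
      have lower: "(1 - \<delta>) * edist d u w \<le> edist t (?g u) (?g w)" if "u \<in> N" "w \<in> N" for u w
        using G that by blast
      have upper: "edist t (?g u) (?g w) \<le> (1 + \<delta>) * edist d u w" if "u \<in> N" "w \<in> C0" for u w
        using G that by blast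
      have local: "edist t (?g y) (?g x) \<le> 40 * (\<delta> * R)"
        if "y \<in> N" "x \<in> P" "edist d y x \<le> \<delta> * R" for y x
        using G that by (simp add: cballP_def)
      note E = embedding_preserves_kcenter[OF P k(1) k' t1 \<delta>(1,2) mat_app_in_vecs[of t d G]
          C0(2-6) N(1) net lower upper local]
      show "good G"
        unfolding good_def \<delta>(3)[symmetric] by (intro conjI allI impI E)
    qed simp
  qed
  then obtain B where B: "B \<in> events" "prob B \<le> 1/3" "\<forall>G\<in>space (gauss_mat t d) - B. good G"
    unfolding except_prob_def by blast
  show "\<exists>A \<in> events. prob A \<ge> 2/3 \<and>
        (\<forall>G\<in>A.
          opt_vanilla d k P / (1 + \<epsilon>) \<le> opt_vanilla t k (mat_app t d G ` P) \<and>
          opt_vanilla t k (mat_app t d G ` P) \<le> (1 + \<epsilon>) * opt_vanilla d k P \<and>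
          (\<forall>\<alpha>\<ge>1. \<forall>C. C \<subseteq> P \<longrightarrow> card C = k \<longrightarrow>
             approx_sol t k \<alpha> (mat_app t d G ` P) (mat_app t d G ` C) \<longrightarrow>
             approx_sol d k (\<alpha> * (1 + \<epsilon>)) P C))"
    unfolding good_def[symmetric]
    using B prob_compl[OF B(1)] by (intro bexI[of _ "space (gauss_mat t d) - B"]) auto
qed simp

end
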